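(* Let $K$ be a $2$-field. Then homogeneous polynomials $f_1,\ldots,f_r\in K[T_0,\ldots,T_n]$, $r\leq n$, of odd degrees have a common non-trivial zero in $K^{n+1}$.
   Context: A field $K$ is called a $2$-field if every polynomial $F\in K[X]$ in one variable of odd degree has a zero in $K$. A non-trivial zero is a zero different from $(0,\ldots,0)$. *)

theory Defs
  imports "HOL-Library.Poly_Mapping" "HOL-Computational_Algebra.Polynomial"
begin

text \<open>Following the usual encoding, a monomial is a finitely supported exponent map, and a
  polynomial in the variables \<open>T\<^sub>0, T\<^sub>1, \<dots>\<close> is a finitely supported map from monomials to
  coefficients.  The ring operations are those of \<^theory>\<open>HOL-Library.Poly_Mapping\<close>.\<close>

type_synonym 'a mpoly = "(nat \<Rightarrow>\<^sub>0 nat) \<Rightarrow>\<^sub>0 'a"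

definition mpoly_vars :: "'a::zero mpoly \<Rightarrow> nat set"
  where "mpoly_vars p = (\<Union>m\<in>Poly_Mapping.keys p. Poly_Mapping.keys m)"

definition monom_degree :: "(nat \<Rightarrow>\<^sub>0 nat) \<Rightarrow> nat"
  where "monom_degree m = (\<Sum>i\<in>Poly_Mapping.keys m. Poly_Mapping.lookup m i)"

text \<open>The zero polynomial is homogeneous of every degree.\<close>

definition homogeneous_of_degree :: "nat \<Rightarrow> 'a::zero mpoly \<Rightarrow> bool"
  where "homogeneous_of_degree d p \<longleftrightarrow> (\<forall>m\<in>Poly_Mapping.keys p. monom_degree m = d)"

definition mpoly_eval :: "(nat \<Rightarrow> 'a) \<Rightarrow> 'a::comm_semiring_1 mpoly \<Rightarrow> 'a"
  where "mpoly_eval x p =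
    (\<Sum>m\<in>Poly_Mapping.keys p.
       Poly_Mapping.lookup p m * (\<Prod>i\<in>Poly_Mapping.keys m. x i ^ Poly_Mapping.lookup m i))"

definition two_field :: "'a::field itself \<Rightarrow> bool"
  where "two_field K \<longleftrightarrow> (\<forall>F::'a poly. odd (degree F) \<longrightarrow> (\<exists>a. poly F a = 0))"

end

theory Submission
  imports Defs "HOL-Library.Function_Algebras" "Jordan_Normal_Form.Char_Poly"
begin

text \<open>Padding with zero forms, declared to have degree 1, we may assume \<open>r = n\<close>. A form acts on
  functions on monomials by contraction, dually to multiplication of polynomials. For the deformed
  system \<open>T\<^sub>i\<^sup>d\<^sup>i + s f\<^sub>i\<close> the functions of large degree \<open>D\<close> over \<open>K[[s]]\<close> annihilated by all of it
  are given freely by their values at the \<open>e = d\<^sub>1 \<cdots> d\<^sub>n\<close> monomials divisible by no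
  \<open>T\<^sub>i\<^sup>d\<^sup>i\<close>, and the leading coefficients of the solutions that are polynomial in \<open>s\<close> form
  an \<open>e\<close>-dimensional space over \<open>K\<close>. It is annihilated by all \<open>f\<^sub>i\<close>, and each
  \<open>T\<^sub>j\<close> maps the space in degree \<open>D + 1\<close> to the one in degree \<open>D\<close>. Since the
  dimension stays bounded as \<open>D\<close> grows, some linear form \<open>\<Sum> c\<^sup>j T\<^sub>j\<close> acts
  bijectively (the argument of Eakin and Sathaye). Dividing the \<open>T\<^sub>j\<close> by it gives
  commuting operators on a space of odd dimension \<open>e\<close>; over a 2-field they have a common
  eigenvector, and its eigenvalues are the coordinates of a common zero.\<close>

section \<open>Finite-dimensional subspaces\<close>

context vector_space
begin

text \<open>The constants defined here need the qualifier \<open>local\<close>, because the global interpretation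
  \<open>real_vector\<close> shadows their short names.\<close>

definition fin_subspace :: "'b set \<Rightarrow> bool"
  where "fin_subspace U \<longleftrightarrow> subspace U \<and> (\<exists>B. finite B \<and> U \<subseteq> span B)"

lemma fin_subspaceE:
  fixes U :: "'b set"
  assumes "local.fin_subspace U"
  obtains B :: "'b set" where "finite B" "B \<subseteq> U" "independent B" "span B = U" "card B = dim U"
proof -
  obtain T where T: "finite T" "U \<subseteq> span T" and U: "subspace U"
    using assms by (auto simp: local.fin_subspace_def)
  obtain B where B: "B \<subseteq> U" "independent B" "U \<subseteq> span B" "card B = dim U"
    by (rule basis_exists)
  have "finite B"
    using independent_span_bound[OF T(1) B(2)] B(1) T(2) by blast
  moreover have "span B = U"
    using B U by (simp add: span_minimal subset_antisym)
  ultimately show ?thesis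
    using that B by blast
qed

lemma fin_subspace_subset:
  assumes "local.fin_subspace U" "subspace W" "W \<subseteq> U"
  shows "local.fin_subspace W"
  using assms by (auto simp: local.fin_subspace_def)

lemma fin_subspace_dim_mono:
  assumes "local.fin_subspace U" "W \<subseteq> U"
  shows "dim W \<le> dim U"
proof -
  obtain B where "finite B" "span B = U" "card B = dim U"
    using local.fin_subspaceE[OF assms(1)] by blast
  then show ?thesis
    using dim_le_card[of W B] assms(2) by simp
qed

lemma fin_subspace_dim_eq:
  assumes U: "local.fin_subspace U" and W: "subspace W" "W \<subseteq> U" and eq: "dim W = dim U"
  shows "W = U"
proof -
  obtain B where B: "finite B" "B \<subseteq> W" "independent B" "span B = W" "card B = dim W"
    by (rule local.fin_subspaceE[OF local.fin_subspace_subset[OF U W]])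
  obtain C where C: "finite C" "span C = U" "card C = dim U"
    using local.fin_subspaceE[OF U] by blast
  have "u \<in> span B" if u: "u \<in> U" for u
  proof (rule ccontr)
    assume nin: "u \<notin> span B"
    then have "independent (insert u B)"
      using B(3) by (simp add: independent_insertI)
    moreover have "insert u B \<subseteq> span C"
      using u B(2) W(2) C(2) by auto
    ultimately have "card (insert u B) \<le> card C"
      using independent_span_bound C(1) by blast
    moreover have "u \<notin> B"
      using nin span_base by blast
    ultimately show False
      using B(1,5) C(3) eq by simp
  qed
  then show ?thesis
    using B(4) W(2) by blast
qed

lemma fin_subspace_dim_0:
  assumes "local.fin_subspace U" "dim U = 0"
  shows "U = {0}"
proof -
  obtain B where "finite B" "span B = U" "card B = dim U"
    using local.fin_subspaceE[OF assms(1)] by blast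
  then show ?thesis
    using assms(2) by auto
qed

end

section \<open>Images, kernels and the rank-nullity formula\<close>

context vector_space_pair
begin

lemma fin_subspace_image:
  assumes f: "Vector_Spaces.linear s1 s2 f" and U: "vs1.fin_subspace U"
  shows "vs2.fin_subspace (f ` U)"
proof -
  interpret f: Vector_Spaces.linear s1 s2 f by (fact f)
  obtain B where B: "finite B" "vs1.span B = U"
    using vs1.fin_subspaceE[OF U] by blast
  have "f ` U = vs2.span (f ` B)"
    using B(2) f.span_image[of B] by simp
  then show ?thesis
    using B(1) unfolding vs2.fin_subspace_def by (auto intro!: exI[of _ "f ` B"])
qed

lemma subspace_kernel_on:
  assumes f: "Vector_Spaces.linear s1 s2 f" and U: "vs1.subspace U"
  shows "vs1.subspace {u \<in> U. f u = 0}"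
proof -
  interpret f: Vector_Spaces.linear s1 s2 f by (fact f)
  show ?thesis
    using U by (simp add: vs1.subspace_def f.add f.scale)
qed

text \<open>The ambient spaces may be infinite-dimensional; only \<open>U\<close> has finite
  dimension. A basis \<open>B0\<close> of the kernel is extended to a basis \<open>B\<close> of
  \<open>U\<close>, and \<open>f\<close> maps \<open>B - B0\<close> bijectively onto a basis of the
  image.\<close>

lemma rank_nullity:
  assumes f: "Vector_Spaces.linear s1 s2 f" and U: "vs1.fin_subspace U"
  shows "vs1.dim U = vs1.dim {u \<in> U. f u = 0} + vs2.dim (f ` U)"
proof -
  interpret f: Vector_Spaces.linear s1 s2 f by (fact f)
  let ?K = "{u \<in> U. f u = 0}"
  have sU: "vs1.subspace U"
    using U by (simp add: vs1.fin_subspace_def)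
  have sK: "vs1.subspace ?K"
    by (rule subspace_kernel_on[OF f sU])
  obtain B0 where B0: "B0 \<subseteq> ?K" "vs1.independent B0" "vs1.span B0 = ?K" "card B0 = vs1.dim ?K"
    by (rule vs1.fin_subspaceE[OF vs1.fin_subspace_subset[OF U sK]]) auto
  obtain B where B: "B0 \<subseteq> B" "B \<subseteq> U" "vs1.independent B" "U \<subseteq> vs1.span B"
  proof (rule vs1.maximal_independent_subset_extend)
    show "B0 \<subseteq> U"
      using B0(1) by auto
  qed (use B0(2) in auto)
  have spB: "vs1.span B = U"
    using B sU by (simp add: vs1.span_minimal subset_antisym)
  have finB: "finite B"
  proof -
    obtain T where "finite T" "U \<subseteq> vs1.span T"
      using U by (auto simp: vs1.fin_subspace_def)
    then show ?thesis
      using vs1.independent_span_bound[of T B] B(2,3) by blast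
  qed
  have cB: "card B = vs1.dim U"
    using vs1.dim_span_eq_card_independent[OF B(3)] spB by simp
  let ?C = "B - B0"
  have inj: "inj_on f (vs1.span ?C)"
  proof (subst f.inj_on_iff_eq_0[OF vs1.subspace_span], intro ballI impI)
    fix x assume x: "x \<in> vs1.span ?C" "f x = 0"
    have "x \<in> U"
      using x(1) spB vs1.span_mono[of ?C B] by blast
    then have "x \<in> vs1.span B0"
      using x(2) B0(3) by simp
    \<comment> \<open>\<open>x\<close> lies in the spans of the disjoint parts \<open>B0\<close> and
      \<open>B - B0\<close> of one basis, so its coordinates are supported on both parts and
      vanish.\<close>
    then have "vs1.representation B x = vs1.representation B0 x"
      by (rule vs1.representation_extend[OF B(3) _ B(1)])
    moreover have "vs1.representation B x = vs1.representation ?C x"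
      by (rule vs1.representation_extend[OF B(3) x(1)]) blast
    ultimately have "vs1.representation B x b = 0" for b
      by (metis DiffD2 vs1.representation_ne_zero)
    then show "x = 0"
      using vs1.sum_nonzero_representation_eq[OF B(3), of x] \<open>x \<in> U\<close> spB by simp
  qed
  have ind: "vs2.independent (f ` ?C)"
    using f.dependent_inj_imageD inj vs1.independent_mono[OF B(3)] by blast
  have "vs2.span (f ` ?C) = f ` U"
  proof -
    have "f ` B \<subseteq> insert 0 (f ` ?C)"
      using B0(1) by blast
    then have "vs2.span (f ` B) \<subseteq> vs2.span (f ` ?C)"
      using vs2.span_mono[of "f ` B" "insert 0 (f ` ?C)"] by simp
    moreover have "vs2.span (f ` ?C) \<subseteq> vs2.span (f ` B)"
      by (intro vs2.span_mono) blast
    ultimately show ?thesis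
      using spB f.span_image[of B] by simp
  qed
  then have "vs2.dim (f ` U) = card (f ` ?C)"
    using vs2.dim_span_eq_card_independent[OF ind] by simp
  also have "\<dots> = card ?C"
    by (intro card_image inj_on_subset[OF inj] vs1.span_superset)
  also have "\<dots> = card B - card B0"
    using B(1) finB by (simp add: card_Diff_subset finite_subset)
  finally show ?thesis
    using cB B0(4) card_mono[OF finB B(1)] by simp
qed

end

section \<open>Common eigenvectors in odd dimension\<close>

context vector_space
begin

text \<open>The matrix of \<open>f\<close> in a basis of \<open>U\<close> has a characteristic
  polynomial of degree \<open>dim U\<close>. This is odd, so a 2-field contains an
  eigenvalue.\<close>

lemma odd_dim_eigenvector:
  assumes K: "two_field TYPE('a)" and U: "local.fin_subspace U" and odd: "odd (dim U)"
    and f: "Vector_Spaces.linear scale scale f" and inv: "f ` U \<subseteq> U"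
  shows "\<exists>a. \<exists>u\<in>U. u \<noteq> 0 \<and> f u = scale a u"
proof -
  interpret f: Vector_Spaces.linear scale scale f by (fact f)
  obtain B :: "'b set" where B: "finite B" "B \<subseteq> U" "independent B" "span B = U" "card B = dim U"
    by (rule local.fin_subspaceE[OF U])
  define n where "n = card B"
  obtain b where b: "bij_betw b {0..<n} B"
    using ex_bij_betw_nat_finite[OF B(1)] unfolding n_def by blast
  have bB: "b i \<in> B" if "i < n" for i
    using b that by (auto simp: bij_betw_def)
  define M where "M = mat n n (\<lambda>(i, j). representation B (f (b j)) (b i))"
  have M: "M \<in> carrier_mat n n"
    by (simp add: M_def)
  have "odd (degree (char_poly M))"
    using degree_monic_char_poly[OF M] odd B(5) by (simp add: n_def)
  then obtain a where "poly (char_poly M) a = 0"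
    using K unfolding two_field_def by blast
  then have "eigenvalue M a"
    using eigenvalue_root_char_poly[OF M] by simp
  then obtain v where v: "v \<in> carrier_vec n" "v \<noteq> 0\<^sub>v n" "M *\<^sub>v v = a \<cdot>\<^sub>v v"
    using M by (auto simp: eigenvalue_def eigenvector_def)
  define u where "u = (\<Sum>j\<in>{0..<n}. scale (v $ j) (b j))"
  have Mv: "(\<Sum>j\<in>{0..<n}. representation B (f (b j)) (b i) * v $ j) = a * v $ i" if "i < n" for i
  proof -
    have "(M *\<^sub>v v) $ i = (\<Sum>j\<in>{0..<n}. representation B (f (b j)) (b i) * v $ j)"
      using that v(1) M by (simp add: M_def scalar_prod_def)
    then show ?thesis
      using v that by simp
  qed
  have fb: "f (b j) = (\<Sum>i\<in>{0..<n}. scale (representation B (f (b j)) (b i)) (b i))" if "j < n" for j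
  proof -
    have "f (b j) \<in> span B"
      using bB[OF that] B(2,4) inv by auto
    then have "f (b j) = (\<Sum>x\<in>B. scale (representation B (f (b j)) x) x)"
      using sum_representation_eq[OF B(3) _ B(1) order_refl] by simp
    then show ?thesis
      using sum.reindex_bij_betw[OF b, of "\<lambda>x. scale (representation B (f (b j)) x) x"] by simp
  qed
  have "f u = (\<Sum>j\<in>{0..<n}. scale (v $ j) (f (b j)))"
    by (simp add: u_def f.sum f.scale)
  also have "\<dots> = (\<Sum>j\<in>{0..<n}. \<Sum>i\<in>{0..<n}. scale (representation B (f (b j)) (b i) * v $ j) (b i))"
  proof (rule sum.cong[OF refl])
    fix j assume "j \<in> {0..<n}"
    then have "scale (v $ j) (f (b j))
        = scale (v $ j) (\<Sum>i\<in>{0..<n}. scale (representation B (f (b j)) (b i)) (b i))"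
      using fb[of j] by simp
    then show "scale (v $ j) (f (b j))
        = (\<Sum>i\<in>{0..<n}. scale (representation B (f (b j)) (b i) * v $ j) (b i))"
      by (simp add: scale_sum_right mult.commute)
  qed
  also have "\<dots> = (\<Sum>i\<in>{0..<n}. scale (\<Sum>j\<in>{0..<n}. representation B (f (b j)) (b i) * v $ j) (b i))"
    by (subst sum.swap) (simp add: scale_sum_left)
  also have "\<dots> = scale a u"
    by (simp add: Mv u_def scale_sum_right)
  finally have "f u = scale a u" .
  moreover have "u \<in> U"
    unfolding u_def B(4)[symmetric] using bB by (intro span_sum span_scale span_base) auto
  moreover have "u \<noteq> 0"
  proof
    assume "u = 0"
    obtain i where i: "i < n" "v $ i \<noteq> 0"
      using v(1,2) by (metis eq_vecI carrier_vecD index_zero_vec)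
    \<comment> \<open>Independence of \<open>B\<close> speaks of coefficients indexed by basis
      vectors, so the coordinates of \<open>v\<close> are moved along \<open>b\<close>.\<close>
    define g where "g = (\<lambda>x. v $ (inv_into {0..<n} b x))"
    have g: "g (b j) = v $ j" if "j < n" for j
      using that b by (simp add: g_def bij_betw_def inv_into_f_f)
    have "(\<Sum>x\<in>B. scale (g x) x) = (\<Sum>j\<in>{0..<n}. scale (g (b j)) (b j))"
      by (rule sum.reindex_bij_betw[OF b, symmetric])
    also have "\<dots> = 0"
      using \<open>u = 0\<close> by (simp add: g u_def)
    finally have "g (b i) = 0"
      using independentD[OF B(3) B(1) order_refl] bB[OF i(1)] by blast
    then show False
      using g i by simp
  qed
  ultimately show ?thesis
    by blast
qed

text \<open>Induction on the dimension. If some \<open>Y j\<close> is not scalar on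
  \<open>U\<close>, subtracting one of its eigenvalues gives a map \<open>Z\<close> whose kernel and
  image on \<open>U\<close> have smaller dimension and are invariant under all operators. The two
  dimensions add up to the odd number \<open>dim U\<close>, so one of them is odd.\<close>

lemma odd_dim_common_eigenvector:
  assumes K: "two_field TYPE('a)"
    and lin: "\<And>j. j \<in> J \<Longrightarrow> Vector_Spaces.linear scale scale (Y j)"
    and "local.fin_subspace U" "odd (dim U)"
    and "\<And>j. j \<in> J \<Longrightarrow> Y j ` U \<subseteq> U"
    and "\<And>i j u. \<lbrakk>i \<in> J; j \<in> J; u \<in> U\<rbrakk> \<Longrightarrow> Y i (Y j u) = Y j (Y i u)"
  shows "\<exists>u\<in>U. u \<noteq> 0 \<and> (\<forall>j\<in>J. \<exists>a. Y j u = scale a u)"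
  using assms(3-)
proof (induction "dim U" arbitrary: U rule: less_induct)
  case less
  note U = less.prems(1) and odd = less.prems(2) and inv = less.prems(3) and comm = less.prems(4)
  interpret vector_space_pair scale scale
    by unfold_locales
  have sU: "subspace U"
    using U by (simp add: local.fin_subspace_def)
  show ?case
  proof (cases "\<forall>j\<in>J. \<exists>a. \<forall>u\<in>U. Y j u = scale a u")
    case True
    have "U \<noteq> {0}"
      using odd dim_le_card[of "{0}" "{}"] by auto
    then obtain u where "u \<in> U" "u \<noteq> 0"
      using sU subspace_0 by blast
    with True show ?thesis
      by blast
  next
    case False
    then obtain j where j: "j \<in> J" and ns: "\<And>a. \<exists>u\<in>U. Y j u \<noteq> scale a u"
      by blast
    interpret Yj: Vector_Spaces.linear scale scale "Y j"
      by (rule lin[OF j])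
    obtain a u where u: "u \<in> U" "u \<noteq> 0" "Y j u = scale a u"
      using odd_dim_eigenvector[OF K U odd lin[OF j] inv[OF j]] by blast
    define Z where "Z = (\<lambda>u. Y j u - scale a u)"
    have Z: "Vector_Spaces.linear scale scale Z"
      by unfold_locales
        (auto simp: Z_def Yj.add Yj.scale scale_right_distrib scale_right_diff_distrib mult.commute)
    interpret Z: Vector_Spaces.linear scale scale Z
      by (fact Z)
    have ZU: "Z v \<in> U" if "v \<in> U" for v
      using that inv[OF j] sU by (auto simp: Z_def intro!: subspace_diff subspace_scale)
    have YZ: "Y i (Z v) = Z (Y i v)" if "i \<in> J" "v \<in> U" for i v
    proof -
      interpret Yi: Vector_Spaces.linear scale scale "Y i"
        by (rule lin[OF that(1)])
      show ?thesis
        using comm[OF that(1) j that(2)] by (simp add: Z_def Yi.diff Yi.scale)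
    qed
    let ?K = "{v \<in> U. Z v = 0}" and ?I = "Z ` U"
    have sub: "?K \<subseteq> U" "?I \<subseteq> U"
      using ZU by auto
    have sK: "subspace ?K" and sI: "subspace ?I"
      using sU Z.subspace_image[OF sU] by (simp_all add: subspace_def Z.add Z.scale)
    have fK: "local.fin_subspace ?K" and fI: "local.fin_subspace ?I"
      using local.fin_subspace_subset[OF U sK sub(1)] local.fin_subspace_subset[OF U sI sub(2)] by auto
    have sum: "dim U = dim ?K + dim ?I"
      by (rule rank_nullity[OF Z U])
    have "?K \<noteq> U"
    proof
      assume "?K = U"
      then have "\<forall>v\<in>U. Y j v = scale a v"
        by (auto simp: Z_def)
      then show False
        using ns by blast
    qed
    then have K_less: "dim ?K < dim U"
      using local.fin_subspace_dim_eq[OF U sK sub(1)] sum by linarith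
    have "?K \<noteq> {0}"
      using u by (auto simp: Z_def)
    then have "dim ?K \<noteq> 0"
      using local.fin_subspace_dim_0[OF fK] by blast
    then have I_less: "dim ?I < dim U"
      using sum by linarith
    have invK: "Y i ` ?K \<subseteq> ?K" if i: "i \<in> J" for i
    proof -
      interpret Yi: Vector_Spaces.linear scale scale "Y i"
        by (rule lin[OF i])
      show ?thesis
        using inv[OF i] YZ[OF i] by (auto simp: image_subset_iff) (metis Yi.zero)
    qed
    have invI: "Y i ` ?I \<subseteq> ?I" if i: "i \<in> J" for i
      using inv[OF i] YZ[OF i] by (auto simp: image_subset_iff)
    have comm_sub: "Y i (Y k v) = Y k (Y i v)" if "W \<subseteq> U" "i \<in> J" "k \<in> J" "v \<in> W" for W i k v
      using comm that by blast
    have "odd (dim ?K) \<or> odd (dim ?I)"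
      using odd sum by simp
    then show ?thesis
    proof
      assume "odd (dim ?K)"
      from less.hyps[OF K_less fK this invK comm_sub[OF sub(1)]] show ?thesis
        using sub(1) by blast
    next
      assume "odd (dim ?I)"
      from less.hyps[OF I_less fI this invI comm_sub[OF sub(2)]] show ?thesis
        using sub(2) by blast
    qed
  qed
qed

end

section \<open>Contraction of functions on monomials\<close>

definition fscale :: "'k::field \<Rightarrow> ('x \<Rightarrow> 'k) \<Rightarrow> 'x \<Rightarrow> 'k"
  where "fscale c f = (\<lambda>x. c * f x)"

lemma fscale_apply: "fscale c f x = c * f x"
  by (simp add: fscale_def)

global_interpretation fun_space: vector_space "fscale :: 'k::field \<Rightarrow> ('x \<Rightarrow> 'k) \<Rightarrow> 'x \<Rightarrow> 'k"
  by unfold_locales (auto simp: fun_eq_iff fscale_apply algebra_simps)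

global_interpretation fun_pair: vector_space_pair
  "fscale :: 'k::field \<Rightarrow> ('x \<Rightarrow> 'k) \<Rightarrow> 'x \<Rightarrow> 'k" "fscale :: 'k \<Rightarrow> ('y \<Rightarrow> 'k) \<Rightarrow> 'y \<Rightarrow> 'k"
  by unfold_locales

abbreviation fun_linear :: "(('x \<Rightarrow> 'k::field) \<Rightarrow> 'y \<Rightarrow> 'k) \<Rightarrow> bool"
  where "fun_linear \<equiv> Vector_Spaces.linear fscale fscale"

lemma fun_linearI:
  assumes "\<And>f g y. L (f + g) y = L f y + L g y" "\<And>c f y. L (fscale c f) y = c * L f y"
  shows "fun_linear L"
  by unfold_locales (use assms in \<open>auto simp: fun_eq_iff fscale_apply\<close>)

lemma fun_apply_sum: "(\<Sum>a\<in>A. F a) x = (\<Sum>a\<in>A. F a x)"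
  for F :: "'a \<Rightarrow> 'x \<Rightarrow> 'b::comm_monoid_add"
  by (induction A rule: infinite_finite_induct) auto

definition supported_on :: "'x set \<Rightarrow> ('x \<Rightarrow> 'k::field) set"
  where "supported_on S = {f. \<forall>x. f x \<noteq> 0 \<longrightarrow> x \<in> S}"

lemma supported_onD: "f \<in> supported_on S \<Longrightarrow> x \<notin> S \<Longrightarrow> f x = 0"
  by (auto simp: supported_on_def)

lemma subspace_supported_on: "fun_space.subspace (supported_on S)"
  by (auto simp: fun_space.subspace_def supported_on_def fscale_apply) (metis add_0)

lemma
  assumes "finite S"
  shows fin_subspace_supported_on: "fun_space.fin_subspace (supported_on S :: ('x \<Rightarrow> 'k::field) set)"
    and dim_supported_on: "fun_space.dim (supported_on S :: ('x \<Rightarrow> 'k::field) set) = card S"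
proof -
  define e :: "'x \<Rightarrow> 'x \<Rightarrow> 'k" where "e x = (\<lambda>y. if y = x then 1 else 0)" for x
  have inj: "inj e"
    by (auto simp: inj_on_def e_def fun_eq_iff split: if_splits)
  have comb: "(\<Sum>x\<in>S. fscale (c x) (e x)) y = (if y \<in> S then c y else 0)" for c :: "'x \<Rightarrow> 'k" and y
    using assms by (simp add: fun_apply_sum fscale_apply e_def if_distrib cong: if_cong)
  have sub: "e ` S \<subseteq> supported_on S"
    by (auto simp: supported_on_def e_def split: if_splits)
  have "f \<in> fun_space.span (e ` S)" if "f \<in> supported_on S" for f
  proof -
    have "f = (\<Sum>x\<in>S. fscale (f x) (e x))"
      using supported_onD[OF that] by (auto simp: fun_eq_iff comb)
    also have "\<dots> \<in> fun_space.span (e ` S)"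
      by (intro fun_space.span_sum fun_space.span_scale fun_space.span_base) auto
    finally show ?thesis .
  qed
  then have sp: "supported_on S \<subseteq> fun_space.span (e ` S)"
    by blast
  then show "fun_space.fin_subspace (supported_on S :: ('x \<Rightarrow> 'k) set)"
    unfolding fun_space.fin_subspace_def using assms subspace_supported_on by blast
  have "fun_space.independent (e ` S)"
  proof (rule fun_space.independent_if_scalars_zero)
    fix g x assume "(\<Sum>x\<in>e ` S. fscale (g x) x) = 0" and x: "x \<in> e ` S"
    then have "(\<Sum>x\<in>S. fscale (g (e x)) (e x)) = 0"
      by (simp add: sum.reindex inj_on_subset[OF inj])
    then have "(if y \<in> S then g (e y) else 0) = 0" for y
      using comb[of "\<lambda>x. g (e x)" y] by simp
    moreover obtain y where "y \<in> S" "x = e y"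
      using x by blast
    ultimately show "g x = 0"
      by metis
  qed (use assms in simp)
  then show "fun_space.dim (supported_on S :: ('x \<Rightarrow> 'k) set) = card S"
    by (rule fun_space.dim_unique[OF sub sp]) (simp add: card_image inj_on_subset[OF inj])
qed

text \<open>Over a finite field the product of all \<open>X - a\<close> vanishes everywhere. Either
  it or \<open>X\<close> times it has odd degree, and adding 1 gives a polynomial of odd degree
  without zeros. The infinitely many scalars are the supply for
  \<open>pencil_injective\<close>.\<close>

lemma two_field_infinite:
  assumes "two_field TYPE('k::field)"
  shows "infinite (UNIV :: 'k set)"
proof
  assume fin: "finite (UNIV :: 'k set)"
  define p where "p = (\<Prod>a\<in>(UNIV :: 'k set). [:- a, 1:])"
  have deg: "degree p = card (UNIV :: 'k set)"
    unfolding p_def by (subst degree_prod_eq_sum_degree) auto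
  have root: "poly p x = 0" for x
    using fin by (auto simp: p_def poly_prod)
  have "card (UNIV :: 'k set) \<noteq> 0"
    using fin by simp
  then have p0: "p \<noteq> 0" "0 < degree p"
    using deg by auto
  define q where "q = (if odd (degree p) then p else pCons 0 p)"
  have "odd (degree q)"
    using p0 by (auto simp: q_def)
  moreover have "0 < degree q"
    using p0 by (auto simp: q_def)
  then have "degree (q + 1) = degree q"
    by (simp add: degree_add_eq_left)
  ultimately obtain x where "poly (q + 1) x = 0"
    using assms unfolding two_field_def by metis
  then show False
    by (auto simp: q_def root split: if_splits)
qed

section \<open>Monomials of a given degree\<close>

lemma monom_degree_superset:
  assumes "finite A" "Poly_Mapping.keys m \<subseteq> A"
  shows "monom_degree m = (\<Sum>i\<in>A. Poly_Mapping.lookup m i)"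
  unfolding monom_degree_def by (rule sum.mono_neutral_left) (use assms in \<open>auto simp: in_keys_iff\<close>)

lemma keys_plus_nat: "Poly_Mapping.keys (m + m') = Poly_Mapping.keys m \<union> Poly_Mapping.keys m'"
  for m m' :: "'a \<Rightarrow>\<^sub>0 nat"
  by (auto simp: in_keys_iff lookup_add)

lemma monom_degree_plus: "monom_degree (m + m') = monom_degree m + monom_degree m'"
proof -
  let ?A = "Poly_Mapping.keys m \<union> Poly_Mapping.keys m'"
  have "monom_degree (m + m') = (\<Sum>i\<in>?A. Poly_Mapping.lookup (m + m') i)"
    by (rule monom_degree_superset) (auto simp: keys_plus_nat)
  also have "\<dots> = monom_degree m + monom_degree m'"
    by (simp add: lookup_add sum.distrib monom_degree_superset[of ?A])
  finally show ?thesis .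
qed

lemma monom_degree_single: "monom_degree (Poly_Mapping.single i k) = k"
  by (simp add: monom_degree_def)

definition monoms :: "nat \<Rightarrow> nat \<Rightarrow> (nat \<Rightarrow>\<^sub>0 nat) set"
  where "monoms n D = {m. Poly_Mapping.keys m \<subseteq> {0..n} \<and> monom_degree m = D}"

lemma monoms_plus_iff:
  assumes "Poly_Mapping.keys \<mu> \<subseteq> {0..n}"
  shows "m + \<mu> \<in> monoms n D \<longleftrightarrow> monom_degree \<mu> \<le> D \<and> m \<in> monoms n (D - monom_degree \<mu>)"
  using assms by (auto simp: monoms_def keys_plus_nat monom_degree_plus)

lemma finite_monoms: "finite (monoms n D)"
proof (rule finite_subset)
  let ?F = "{0..n} \<rightarrow>\<^sub>E {0..D}"
  let ?g = "\<lambda>m. restrict (Poly_Mapping.lookup m) {0..n}"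
  show "monoms n D \<subseteq> ?g -` ?F \<inter> monoms n D"
  proof
    fix m assume m: "m \<in> monoms n D"
    have "Poly_Mapping.lookup m i \<le> D" if "i \<in> {0..n}" for i
    proof -
      have "monom_degree m = (\<Sum>i\<in>{0..n}. Poly_Mapping.lookup m i)"
        using m by (intro monom_degree_superset) (auto simp: monoms_def)
      then show ?thesis
        using m member_le_sum[of i "{0..n}" "Poly_Mapping.lookup m"] that by (simp add: monoms_def)
    qed
    then show "m \<in> ?g -` ?F \<inter> monoms n D"
      using m by (auto simp: PiE_def extensional_def)
  qed
  show "finite (?g -` ?F \<inter> monoms n D)"
  proof (rule finite_vimage_IntI)
    show "finite ?F"
      by (intro finite_PiE) auto
    show "inj_on ?g (monoms n D)"
    proof (rule inj_onI)
      fix m m' assume m: "m \<in> monoms n D" "m' \<in> monoms n D" and eq: "?g m = ?g m'"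
      have "Poly_Mapping.lookup m i = Poly_Mapping.lookup m' i" for i
      proof (cases "i \<in> {0..n}")
        case True
        then show ?thesis
          using fun_cong[OF eq, of i] by simp
      next
        case False
        then have "i \<notin> Poly_Mapping.keys m" "i \<notin> Poly_Mapping.keys m'"
          using m by (auto simp: monoms_def)
        then show ?thesis
          by (simp add: in_keys_iff)
      qed
      then show "m = m'"
        by (simp add: poly_mapping_eqI)
    qed
  qed
qed

text \<open>If \<open>\<phi>\<close> is extended linearly from monomials to polynomials, this is its
  value at the product of \<open>m\<close> and \<open>f\<close>. Contraction is thus the transpose
  of multiplication by \<open>f\<close>.\<close>

definition contract :: "'k::field mpoly \<Rightarrow> ((nat \<Rightarrow>\<^sub>0 nat) \<Rightarrow> 'k) \<Rightarrow> (nat \<Rightarrow>\<^sub>0 nat) \<Rightarrow> 'k"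
  where "contract f \<phi> m = (\<Sum>\<mu>\<in>Poly_Mapping.keys f. Poly_Mapping.lookup f \<mu> * \<phi> (m + \<mu>))"

lemma contract_commute: "contract f (contract g \<phi>) m = contract g (contract f \<phi>) m"
  unfolding contract_def
  by (simp add: sum_distrib_left, subst sum.swap) (simp add: ac_simps)

lemma contract_add: "contract f (\<lambda>m. \<phi> m + \<psi> m) m = contract f \<phi> m + contract f \<psi> m"
  by (simp add: contract_def algebra_simps sum.distrib)

lemma contract_scale: "contract f (\<lambda>m. c * \<phi> m) m = c * contract f \<phi> m"
  by (simp add: contract_def sum_distrib_left ac_simps)

lemma contract_uminus: "contract f (\<lambda>m. - \<phi> m) m = - contract f \<phi> m"
  by (simp add: contract_def sum_negf)

lemma contract_zero: "contract f (\<lambda>m. 0) m = 0"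
  by (simp add: contract_def)

lemma contract_translate: "contract f (\<lambda>m. \<phi> (m + \<mu>)) m = contract f \<phi> (m + \<mu>)"
  by (simp add: contract_def ac_simps)

text \<open>Contraction by a form of degree \<open>d\<close> lowers degrees by \<open>d\<close> and
  kills everything of degree below \<open>d\<close>; under truncated subtraction the latter must be
  recorded as \<open>d \<le> D\<close>.\<close>

lemma contract_nonzero_monoms:
  assumes "mpoly_vars f \<subseteq> {0..n}" "homogeneous_of_degree d f"
    and "\<phi> \<in> supported_on (monoms n D)" "contract f \<phi> m \<noteq> 0"
  shows "d \<le> D \<and> m \<in> monoms n (D - d)"
proof -
  obtain \<mu> where \<mu>: "\<mu> \<in> Poly_Mapping.keys f" "\<phi> (m + \<mu>) \<noteq> 0"
    using assms(4) unfolding contract_def by (rule sum.not_neutral_contains_not_neutral) auto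
  have "Poly_Mapping.keys \<mu> \<subseteq> {0..n}" "monom_degree \<mu> = d"
    using \<mu>(1) assms(1,2) by (auto simp: mpoly_vars_def homogeneous_of_degree_def)
  moreover have "m + \<mu> \<in> monoms n D"
    using \<mu>(2) assms(3) by (auto simp: supported_on_def)
  ultimately show ?thesis
    using monoms_plus_iff by auto
qed

section \<open>Linear forms acting injectively\<close>

text \<open>Contraction by the linear form with coefficients \<open>c ^ j\<close>. Powers of a
  single scalar are taken because any \<open>n + 1\<close> distinct values of \<open>c\<close> then
  give a basis of the linear forms, by Vandermonde.\<close>

definition pencil :: "nat \<Rightarrow> 'k::field \<Rightarrow> ((nat \<Rightarrow>\<^sub>0 nat) \<Rightarrow> 'k) \<Rightarrow> (nat \<Rightarrow>\<^sub>0 nat) \<Rightarrow> 'k"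
  where "pencil n c \<phi> = (\<lambda>m. \<Sum>j\<in>{0..n}. c ^ j * \<phi> (m + Poly_Mapping.single j 1))"

lemma linear_pencil: "fun_linear (pencil n c)"
  by (rule fun_linearI)
    (simp_all add: pencil_def fscale_apply algebra_simps sum.distrib sum_distrib_left)

lemma pencil_commute: "pencil n b (pencil n c \<phi>) = pencil n c (pencil n b \<phi>)"
  unfolding pencil_def fun_eq_iff
  by (simp add: sum_distrib_left, subst sum.swap) (simp add: ac_simps)

lemma pencil_translate: "pencil n c (\<lambda>m. \<phi> (m + \<mu>)) m = pencil n c \<phi> (m + \<mu>)"
  by (simp add: pencil_def ac_simps)

lemma translate_supported:
  assumes "\<phi> \<in> supported_on (monoms n (D + monom_degree \<mu>))" "Poly_Mapping.keys \<mu> \<subseteq> {0..n}"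
  shows "(\<lambda>m. \<phi> (m + \<mu>)) \<in> supported_on (monoms n D)"
proof -
  have "m \<in> monoms n D" if "\<phi> (m + \<mu>) \<noteq> 0" for m
  proof -
    have "m + \<mu> \<in> monoms n (D + monom_degree \<mu>)"
      using assms(1) that by (simp add: supported_on_def)
    then show ?thesis
      by (simp add: monoms_plus_iff[OF assms(2)])
  qed
  then show ?thesis
    by (simp add: supported_on_def)
qed

lemma pencil_supported:
  assumes "\<phi> \<in> supported_on (monoms n (Suc D))"
  shows "pencil n c \<phi> \<in> supported_on (monoms n D)"
proof -
  have "(\<lambda>m. \<phi> (m + Poly_Mapping.single j 1)) \<in> supported_on (monoms n D)" if "j \<in> {0..n}" for j
    by (rule translate_supported) (use assms that in \<open>auto simp: monom_degree_single\<close>)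
  then have "pencil n c \<phi> m = 0" if "m \<notin> monoms n D" for m
    unfolding pencil_def using that supported_onD by (intro sum.neutral ballI) fastforce
  then show ?thesis
    by (auto simp: supported_on_def)
qed

text \<open>Every monomial of positive degree is divisible by some variable.\<close>

lemma eq_zero_if_translates_zero:
  assumes "\<phi> \<in> supported_on (monoms n (Suc D))"
    and "\<And>j m. j \<in> {0..n} \<Longrightarrow> \<phi> (m + Poly_Mapping.single j 1) = 0"
  shows "\<phi> = 0"
proof (rule ccontr)
  assume "\<phi> \<noteq> 0"
  then obtain m where m: "\<phi> m \<noteq> 0"
    by (auto simp: fun_eq_iff)
  then have m': "Poly_Mapping.keys m \<subseteq> {0..n}" "monom_degree m = Suc D"
    using assms(1) by (auto simp: supported_on_def monoms_def)
  then obtain j where j: "j \<in> Poly_Mapping.keys m"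
    unfolding monom_degree_def by fastforce
  have "m = (m - Poly_Mapping.single j 1) + Poly_Mapping.single j 1"
    using j by (intro poly_mapping_eqI)
      (auto simp: lookup_add lookup_minus lookup_single in_keys_iff when_def)
  then show False
    using assms(2)[of j "m - Poly_Mapping.single j 1"] j m m'(1) by auto
qed

text \<open>For fixed \<open>m\<close> the values at the \<open>m + single j 1\<close> are the
  coefficients of a polynomial of degree at most \<open>n\<close>, whose value at \<open>c\<close>
  is \<open>pencil n c \<phi> m\<close>. It has \<open>n + 1\<close> roots, so it is zero.\<close>

lemma translates_zero_if_pencil_zero:
  assumes "finite C" "card C = Suc n" "\<And>c. c \<in> C \<Longrightarrow> pencil n c \<phi> = 0" and j: "j \<in> {0..n}"
  shows "\<phi> (m + Poly_Mapping.single j 1) = 0"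
proof -
  define p where "p = (\<Sum>j\<in>{0..n}. Polynomial.monom (\<phi> (m + Poly_Mapping.single j 1)) j)"
  have "degree p \<le> n"
    unfolding p_def by (intro degree_sum_le) (auto intro: order_trans[OF degree_monom_le])
  have "poly p c = pencil n c \<phi> m" for c
    by (simp add: p_def pencil_def poly_sum poly_monom mult.commute)
  then have roots: "C \<subseteq> {c. poly p c = 0}"
    using assms(3) by auto
  have "p = 0"
  proof (rule ccontr)
    assume "p \<noteq> 0"
    then have "card C \<le> degree p"
      using card_mono[OF poly_roots_finite roots] card_poly_roots_bound[of p] by linarith
    then show False
      using \<open>degree p \<le> n\<close> assms(2) by simp
  qed
  then have "Polynomial.coeff p j = 0"
    by simp
  then show ?thesis
    using j by (simp add: p_def coeff_sum)
qed

text \<open>Induction on \<open>D\<close>: a linear form with a nonzero kernel on \<open>E\<close>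
  maps \<open>E\<close> to a space of smaller dimension, one degree lower. The finite set
  \<open>S\<close> of forbidden scalars lets the induction hypothesis deliver new scalars again and
  again.\<close>

lemma pencil_injective:
  fixes E :: "((nat \<Rightarrow>\<^sub>0 nat) \<Rightarrow> 'k::field) set"
  assumes inf: "infinite (UNIV :: 'k set)"
    and "fun_space.subspace E" "E \<subseteq> supported_on (monoms n D)" "fun_space.dim E \<le> D" "finite S"
  shows "\<exists>c. c \<notin> S \<and> (\<forall>\<phi>\<in>E. pencil n c \<phi> = 0 \<longrightarrow> \<phi> = 0)"
  using assms(2-)
proof (induction D arbitrary: E S)
  case 0
  have "fun_space.fin_subspace E"
    using fun_space.fin_subspace_subset[OF fin_subspace_supported_on[OF finite_monoms]] 0 by blast
  then have "E = {0}"
    using fun_space.fin_subspace_dim_0 0 by blast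
  then show ?case
    using ex_new_if_finite[OF inf \<open>finite S\<close>] by auto
next
  case (Suc D)
  have fE: "fun_space.fin_subspace E"
    using fun_space.fin_subspace_subset[OF fin_subspace_supported_on[OF finite_monoms]] Suc.prems by blast
  define N where "N c = {\<phi> \<in> E. pencil n c \<phi> = 0}" for c
  show ?case
  proof (rule ccontr)
    assume no: "\<nexists>c. c \<notin> S \<and> (\<forall>\<phi>\<in>E. pencil n c \<phi> = 0 \<longrightarrow> \<phi> = 0)"
    \<comment> \<open>The induction hypothesis for the image of \<open>E\<close> under
      \<open>pencil n c\<close> gives a new \<open>c'\<close> that is injective there. Pencils
      commute, so \<open>pencil n c' \<phi> = 0\<close> puts \<open>pencil n c \<phi>\<close> into
      the kernel of \<open>pencil n c'\<close>, and it vanishes.\<close>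
    have step: "\<exists>c'. c' \<notin> S' \<and> N c' \<subseteq> N c" if c: "c \<notin> S" and S': "finite S'" for c S'
    proof -
      interpret L: Vector_Spaces.linear fscale fscale "pencil n c"
        by (rule linear_pencil)
      have sN: "fun_space.subspace (N c)"
        unfolding N_def by (rule fun_pair.subspace_kernel_on[OF linear_pencil Suc.prems(1)])
      have "N c \<noteq> {0}"
        using no c by (auto simp: N_def)
      then have "fun_space.dim (N c) \<noteq> 0"
        using fun_space.fin_subspace_dim_0[OF fun_space.fin_subspace_subset[OF fE sN]] by (auto simp: N_def)
      then have "fun_space.dim (pencil n c ` E) \<le> D"
        using fun_pair.rank_nullity[OF linear_pencil fE, of n c] Suc.prems(3) by (simp add: N_def)
      moreover have "fun_space.subspace (pencil n c ` E)"
        by (rule L.subspace_image[OF Suc.prems(1)])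
      moreover have "pencil n c ` E \<subseteq> supported_on (monoms n D)"
        using pencil_supported Suc.prems(2) by blast
      ultimately have "\<exists>c'. c' \<notin> S' \<and> (\<forall>\<psi>\<in>pencil n c ` E. pencil n c' \<psi> = 0 \<longrightarrow> \<psi> = 0)"
        by (intro Suc.IH S')
      then obtain c' where c': "c' \<notin> S'"
        "\<And>\<phi>. \<phi> \<in> E \<Longrightarrow> pencil n c' (pencil n c \<phi>) = 0 \<Longrightarrow> pencil n c \<phi> = 0"
        by blast
      have "N c' \<subseteq> N c"
        using c'(2) by (auto simp: N_def pencil_commute[of n c' c] L.zero)
      then show ?thesis
        using c'(1) by blast
    qed
    \<comment> \<open>Iterating the step yields a kernel \<open>N c\<close> contained in the kernels
      of \<open>Suc k\<close> distinct scalars. For \<open>k = n\<close> all variables kill it, so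
      it is zero, against the assumption \<open>no\<close>.\<close>
    have "\<exists>C c. finite C \<and> card C = Suc k \<and> C \<inter> S = {} \<and> c \<notin> S \<and> (\<forall>b\<in>C. N c \<subseteq> N b)" for k
    proof (induction k)
      case 0
      obtain c where "c \<notin> S"
        using ex_new_if_finite[OF inf \<open>finite S\<close>] by blast
      then show ?case
        by (intro exI[of _ "{c}"] exI[of _ c]) auto
    next
      case (Suc k)
      then obtain C c where C: "finite C" "card C = Suc k" "C \<inter> S = {}" "c \<notin> S" "\<forall>b\<in>C. N c \<subseteq> N b"
        by blast
      obtain c' where c': "c' \<notin> S \<union> C" "N c' \<subseteq> N c"
        using step[OF C(4), of "S \<union> C"] C(1) \<open>finite S\<close> by auto
      then show ?case
        using C by (intro exI[of _ "insert c' C"] exI[of _ c']) auto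
    qed
    then obtain C c where C: "finite C" "card C = Suc n" "c \<notin> S" "\<forall>b\<in>C. N c \<subseteq> N b"
      by metis
    have "\<phi> = 0" if "\<phi> \<in> N c" for \<phi>
    proof (rule eq_zero_if_translates_zero)
      show "\<phi> \<in> supported_on (monoms n (Suc D))"
        using that Suc.prems(2) by (auto simp: N_def)
      show "\<phi> (m + Poly_Mapping.single j 1) = 0" if j: "j \<in> {0..n}" for j m
        by (rule translates_zero_if_pencil_zero[OF C(1,2) _ j])
          (use C(4) \<open>\<phi> \<in> N c\<close> in \<open>auto simp: N_def\<close>)
    qed
    then show False
      using no C(3) by (auto simp: N_def)
  qed
qed

section \<open>The limit of the deformed system\<close>

lemma minus_single_plus:
  assumes "k \<le> Poly_Mapping.lookup m i"
  shows "m - Poly_Mapping.single i k + Poly_Mapping.single i k = (m :: 'a \<Rightarrow>\<^sub>0 nat)"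
  using assms by (intro poly_mapping_eqI) (auto simp: lookup_add lookup_minus lookup_single when_def)

lemma lookup_plus_single: "Poly_Mapping.lookup (m + Poly_Mapping.single i k) j
    = Poly_Mapping.lookup m j + (if j = i then k else 0)" for m :: "'a \<Rightarrow>\<^sub>0 nat"
  by (auto simp: lookup_add lookup_single when_def)

text \<open>The form \<open>f i\<close> is paired with the variable \<open>T_i\<close>, whose power
  of the same degree it deforms; \<open>T_0\<close> is left over as a free variable.\<close>

locale form_system =
  fixes n :: nat and f :: "nat \<Rightarrow> 'k::field mpoly" and d :: "nat \<Rightarrow> nat"
  assumes vars: "\<And>i. i \<in> {1..n} \<Longrightarrow> mpoly_vars (f i) \<subseteq> {0..n}"
    and homog: "\<And>i. i \<in> {1..n} \<Longrightarrow> homogeneous_of_degree (d i) (f i)"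
begin

definition reduced :: "nat \<Rightarrow> (nat \<Rightarrow>\<^sub>0 nat) set"
  where "reduced D = {m \<in> monoms n D. \<forall>i\<in>{1..n}. Poly_Mapping.lookup m i < d i}"

text \<open>\<open>\<psi> (k, m)\<close> is the coefficient of \<open>s\<^sup>k\<close> at the monomial \<open>m\<close>: a chain is a solution of
  \<open>(T\<^sub>i\<^sup>d\<^sup>i + s f\<^sub>i) \<psi> = 0\<close> modulo \<open>s\<^sup>q\<^sup>+\<^sup>1\<close>, and a closed chain is an exact one.\<close>

definition chains :: "nat \<Rightarrow> nat \<Rightarrow> (nat \<times> (nat \<Rightarrow>\<^sub>0 nat) \<Rightarrow> 'k) set"
  where "chains D q = {\<psi> \<in> supported_on ({..q} \<times> monoms n D). \<forall>i\<in>{1..n}. \<forall>m.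
    \<psi> (0, m + Poly_Mapping.single i (d i)) = 0 \<and>
    (\<forall>k<q. \<psi> (Suc k, m + Poly_Mapping.single i (d i)) = - contract (f i) (\<lambda>m. \<psi> (k, m)) m)}"

definition closed_chains :: "nat \<Rightarrow> nat \<Rightarrow> (nat \<times> (nat \<Rightarrow>\<^sub>0 nat) \<Rightarrow> 'k) set"
  where "closed_chains D q
    = {\<psi> \<in> chains D q. \<forall>i\<in>{1..n}. \<forall>m. contract (f i) (\<lambda>m. \<psi> (q, m)) m = 0}"

text \<open>Divided by \<open>s^q\<close>, a solution of degree at most \<open>q\<close> in
  \<open>s\<close> takes this coefficient as its value at \<open>s = \<infinity>\<close>, where the
  deformed system degenerates to the forms \<open>f i\<close> themselves.\<close>

definition limits :: "nat \<Rightarrow> nat \<Rightarrow> ((nat \<Rightarrow>\<^sub>0 nat) \<Rightarrow> 'k) set"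
  where "limits D q = (\<lambda>\<psi> m. \<psi> (q, m)) ` closed_chains D q"

section \<open>Chains are determined freely by their values at the reduced monomials\<close>

lemma finite_reduced: "finite (reduced D)"
  unfolding reduced_def using finite_monoms by simp

lemma subspace_chains: "fun_space.subspace (chains D q)"
  using subspace_supported_on[of "{..q} \<times> monoms n D"]
  by (auto simp: chains_def fun_space.subspace_def contract_zero contract_add contract_scale fscale_apply)

lemma subspace_closed_chains: "fun_space.subspace (closed_chains D q)"
  using subspace_chains[of D q]
  by (auto simp: closed_chains_def fun_space.subspace_def contract_zero contract_add contract_scale
      fscale_apply)

lemma fin_subspace_chains: "fun_space.fin_subspace (chains D q)"
  by (rule fun_space.fin_subspace_subset[OF fin_subspace_supported_on[of "{..q} \<times> monoms n D"]])
    (use subspace_chains finite_monoms in \<open>auto simp: chains_def\<close>)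

lemma fin_subspace_closed_chains: "fun_space.fin_subspace (closed_chains D q)"
  by (rule fun_space.fin_subspace_subset[OF fin_subspace_chains subspace_closed_chains])
    (auto simp: closed_chains_def)

text \<open>At a monomial that is not reduced, the relations express the coefficient of
  \<open>s^(k+1)\<close> through that of \<open>s^k\<close>; hence induction on
  \<open>k\<close>.\<close>

lemma chain_eq_zero:
  assumes \<psi>: "\<psi> \<in> chains D q" and red: "\<And>k m. k \<le> q \<Longrightarrow> m \<in> reduced D \<Longrightarrow> \<psi> (k, m) = 0"
  shows "\<psi> = 0"
proof -
  have rel: "\<psi> (0, m + Poly_Mapping.single i (d i)) = 0"
    "k < q \<Longrightarrow> \<psi> (Suc k, m + Poly_Mapping.single i (d i)) = - contract (f i) (\<lambda>m. \<psi> (k, m)) m"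
    if "i \<in> {1..n}" for i k m
    using \<psi> that by (auto simp: chains_def)
  have supp: "\<psi> (k, m) = 0" if "\<not> (k \<le> q \<and> m \<in> monoms n D)" for k m
    using \<psi> that supported_onD[of \<psi> "{..q} \<times> monoms n D" "(k, m)"] by (auto simp: chains_def)
  have "\<forall>m. \<psi> (k, m) = 0" if "k \<le> q" for k
    using that
  proof (induction k)
    case 0
    show ?case
    proof
      fix m
      consider "m \<notin> monoms n D" | "m \<in> reduced D"
        | i where "i \<in> {1..n}" "d i \<le> Poly_Mapping.lookup m i"
        unfolding reduced_def by force
      then show "\<psi> (0, m) = 0"
      proof cases
        case (3 i)
        then show ?thesis
          using rel(1)[of i "m - Poly_Mapping.single i (d i)"] by (simp add: minus_single_plus)
      qed (use supp red in auto)
    qed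
  next
    case (Suc k)
    then have IH: "\<And>m. \<psi> (k, m) = 0"
      by simp
    show ?case
    proof
      fix m
      consider "m \<notin> monoms n D" | "m \<in> reduced D"
        | i where "i \<in> {1..n}" "d i \<le> Poly_Mapping.lookup m i"
        unfolding reduced_def by force
      then show "\<psi> (Suc k, m) = 0"
      proof cases
        case (3 i)
        then show ?thesis
          using rel(2)[of i k "m - Poly_Mapping.single i (d i)"] Suc.prems
          by (simp add: minus_single_plus IH contract_zero)
      qed (use supp red Suc.prems in auto)
    qed
  qed
  then have "\<psi> (k, m) = 0" for k m
    using supp by blast
  then show ?thesis
    by (auto simp: fun_eq_iff)
qed

text \<open>Continues prescribed values \<open>a\<close> at reduced monomials: elsewhere the
  relation of one arbitrarily chosen index is taken as definition. Level 0 has no case distinction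
  because \<open>a\<close> will vanish off the reduced monomials.\<close>

primrec extend :: "(nat \<times> (nat \<Rightarrow>\<^sub>0 nat) \<Rightarrow> 'k) \<Rightarrow> nat \<Rightarrow> (nat \<Rightarrow>\<^sub>0 nat) \<Rightarrow> 'k" where
  "extend a 0 = (\<lambda>m. a (0, m))"
| "extend a (Suc k) = (\<lambda>m.
    if \<forall>i\<in>{1..n}. Poly_Mapping.lookup m i < d i then a (Suc k, m)
    else let i = (SOME i. i \<in> {1..n} \<and> d i \<le> Poly_Mapping.lookup m i)
      in - contract (f i) (extend a k) (m - Poly_Mapping.single i (d i)))"

lemma extend_Suc_cases:
  obtains (reduced) "\<forall>i\<in>{1..n}. Poly_Mapping.lookup m i < d i" "extend a (Suc k) m = a (Suc k, m)"
  | (reducible) i where "i \<in> {1..n}" "d i \<le> Poly_Mapping.lookup m i"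
    "extend a (Suc k) m = - contract (f i) (extend a k) (m - Poly_Mapping.single i (d i))"
proof (cases "\<forall>i\<in>{1..n}. Poly_Mapping.lookup m i < d i")
  case True
  then show ?thesis
    using reduced by simp
next
  case False
  define i where "i = (SOME i. i \<in> {1..n} \<and> d i \<le> Poly_Mapping.lookup m i)"
  have "i \<in> {1..n} \<and> d i \<le> Poly_Mapping.lookup m i"
    unfolding i_def by (rule someI_ex) (use False in force)
  moreover have "extend a (Suc k) m = - contract (f i) (extend a k) (m - Poly_Mapping.single i (d i))"
    unfolding extend.simps Let_def i_def by (rule if_not_P[OF False])
  ultimately show ?thesis
    using reducible by blast
qed

lemma extend_supported:
  assumes a: "a \<in> supported_on (UNIV \<times> reduced D)"
  shows "extend a k \<in> supported_on (monoms n D)"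
proof (induction k)
  case 0
  then show ?case
    using a by (auto simp: supported_on_def reduced_def)
next
  case (Suc k)
  have "m \<in> monoms n D" if nz: "extend a (Suc k) m \<noteq> 0" for m
  proof (cases rule: extend_Suc_cases[of m a k])
    case reduced
    then show ?thesis
      using a nz by (auto simp: supported_on_def reduced_def)
  next
    case (reducible i)
    then have "contract (f i) (extend a k) (m - Poly_Mapping.single i (d i)) \<noteq> 0"
      using nz by simp
    then have "d i \<le> D \<and> m - Poly_Mapping.single i (d i) \<in> monoms n (D - d i)"
      using contract_nonzero_monoms[OF vars homog Suc.IH] reducible(1) by blast
    then have "m - Poly_Mapping.single i (d i) + Poly_Mapping.single i (d i) \<in> monoms n D"
      by (subst monoms_plus_iff) (use reducible(1) in \<open>auto simp: monom_degree_single\<close>)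
    then show ?thesis
      by (simp add: minus_single_plus reducible(2))
  qed
  then show ?case
    by (simp add: supported_on_def del: extend.simps)
qed

lemma extend_0_zero:
  assumes a: "a \<in> supported_on (UNIV \<times> reduced D)" and "i \<in> {1..n}"
  shows "extend a 0 (m + Poly_Mapping.single i (d i)) = 0"
proof -
  have "m + Poly_Mapping.single i (d i) \<notin> reduced D"
    using assms(2) by (force simp: reduced_def lookup_plus_single)
  then show ?thesis
    using a by (auto simp: supported_on_def)
qed

text \<open>The value does not depend on the chosen index because contractions commute: for
  \<open>m + T\<^sub>i\<^sup>d\<^sup>i = p + T\<^sub>i\<^sup>d\<^sup>i + T\<^sub>j\<^sup>d\<^sup>j\<close> both choices lead to the
  contraction by \<open>f\<^sub>i f\<^sub>j\<close> of the previous but one term.\<close>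

lemma extend_Suc_rel:
  assumes a: "a \<in> supported_on (UNIV \<times> reduced D)" and "i \<in> {1..n}"
  shows "extend a (Suc k) (m + Poly_Mapping.single i (d i)) = - contract (f i) (extend a k) m"
  using assms(2)
proof (induction k arbitrary: i m)
  case (0 i m)
  let ?M = "m + Poly_Mapping.single i (d i)"
  show ?case
  proof (cases rule: extend_Suc_cases[of ?M a 0])
    case reduced
    then show ?thesis
      using 0 by (force simp: lookup_plus_single)
  next
    case (reducible j)
    show ?thesis
    proof (cases "j = i")
      case True
      then show ?thesis
        using reducible(3) by simp
    next
      case False
      define p where "p = m - Poly_Mapping.single j (d j)"
      have m: "m = p + Poly_Mapping.single j (d j)"
        using False reducible(2) by (simp add: p_def lookup_plus_single minus_single_plus)
      have M: "?M - Poly_Mapping.single j (d j) = p + Poly_Mapping.single i (d i)"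
        by (simp add: m add.assoc add.commute[of "Poly_Mapping.single j (d j)"])
          (simp add: add.assoc[symmetric])
      \<comment> \<open>At level 0 there is no earlier term to compare with; instead both sides
        vanish by \<open>extend_0_zero\<close>.\<close>
      have "contract g (extend a 0) (p + Poly_Mapping.single l (d l)) = 0" if "l \<in> {1..n}" for g l
        by (subst contract_translate[symmetric], subst extend_0_zero[OF a that]) (rule contract_zero)
      then show ?thesis
        using reducible(1,3) 0 M m by simp
    qed
  qed
next
  case (Suc k i m)
  let ?M = "m + Poly_Mapping.single i (d i)"
  show ?case
  proof (cases rule: extend_Suc_cases[of ?M a "Suc k"])
    case reduced
    then show ?thesis
      using Suc.prems by (force simp: lookup_plus_single)
  next
    case (reducible j)
    show ?thesis
    proof (cases "j = i")
      case True
      then show ?thesis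
        using reducible(3) by simp
    next
      case False
      define p where "p = m - Poly_Mapping.single j (d j)"
      have m: "m = p + Poly_Mapping.single j (d j)"
        using False reducible(2) by (simp add: p_def lookup_plus_single minus_single_plus)
      have M: "?M - Poly_Mapping.single j (d j) = p + Poly_Mapping.single i (d i)"
        by (simp add: m add.assoc add.commute[of "Poly_Mapping.single j (d j)"])
          (simp add: add.assoc[symmetric])
      have *: "contract g (extend a (Suc k)) (p + Poly_Mapping.single l (d l))
          = - contract g (contract (f l) (extend a k)) p" if "l \<in> {1..n}" for g l
        by (subst contract_translate[symmetric], subst Suc.IH[OF that], rule contract_uminus)
      show ?thesis
        using reducible(3) *[OF Suc.prems, of "f j"] *[OF reducible(1), of "f i"]
          contract_commute[of "f i" "f j" "extend a k" p] M m by metis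
    qed
  qed
qed

lemma extend_reduced: "m \<in> reduced D \<Longrightarrow> extend a k m = a (k, m)"
  by (cases k) (auto simp: reduced_def)

lemma chain_exists:
  assumes a: "a \<in> supported_on ({..q} \<times> reduced D)"
  shows "\<exists>\<psi>\<in>chains D q. \<forall>k\<le>q. \<forall>m\<in>reduced D. \<psi> (k, m) = a (k, m)"
proof
  let ?\<psi> = "\<lambda>(k, m). if k \<le> q then extend a k m else 0"
  have a': "a \<in> supported_on (UNIV \<times> reduced D)"
    using a by (auto simp: supported_on_def)
  show "\<forall>k\<le>q. \<forall>m\<in>reduced D. ?\<psi> (k, m) = a (k, m)"
    by (simp add: extend_reduced)
  have "?\<psi> \<in> supported_on ({..q} \<times> monoms n D)"
    using extend_supported[OF a'] by (auto simp: supported_on_def split: if_splits)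
  moreover have "(\<lambda>m. ?\<psi> (k, m)) = extend a k" if "k \<le> q" for k
    using that by auto
  ultimately show "?\<psi> \<in> chains D q"
    using extend_0_zero[OF a'] extend_Suc_rel[OF a'] by (simp add: chains_def del: extend.simps)
qed

text \<open>Restriction to the reduced monomials is an isomorphism: \<open>chain_eq_zero\<close>
  gives injectivity, \<open>chain_exists\<close> surjectivity.\<close>

lemma dim_chains: "fun_space.dim (chains D q) = Suc q * card (reduced D)"
proof -
  define R :: "(nat \<times> (nat \<Rightarrow>\<^sub>0 nat) \<Rightarrow> 'k) \<Rightarrow> nat \<times> (nat \<Rightarrow>\<^sub>0 nat) \<Rightarrow> 'k"
    where "R = (\<lambda>\<psi> x. if x \<in> {..q} \<times> reduced D then \<psi> x else 0)"
  have R: "fun_linear R"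
    by (rule fun_linearI) (auto simp: R_def fscale_apply)
  have "{\<psi> \<in> chains D q. R \<psi> = 0} \<subseteq> {0}"
  proof clarify
    fix \<psi> assume \<psi>: "\<psi> \<in> chains D q" "R \<psi> = 0"
    have "\<psi> (k, m) = 0" if "k \<le> q" "m \<in> reduced D" for k m
      using fun_cong[OF \<psi>(2), of "(k, m)"] that by (simp add: R_def)
    then show "\<psi> = 0"
      using chain_eq_zero[OF \<psi>(1)] by blast
  qed
  then have "fun_space.dim {\<psi> \<in> chains D q. R \<psi> = 0} = 0"
    using fun_space.dim_le_card[of "{\<psi> \<in> chains D q. R \<psi> = 0}" "{}"] by simp
  moreover have "R ` chains D q = supported_on ({..q} \<times> reduced D)"
  proof
    show "R ` chains D q \<subseteq> supported_on ({..q} \<times> reduced D)"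
      by (auto simp: R_def supported_on_def split: if_splits)
    show "supported_on ({..q} \<times> reduced D) \<subseteq> R ` chains D q"
    proof
      fix a :: "nat \<times> (nat \<Rightarrow>\<^sub>0 nat) \<Rightarrow> 'k"
      assume a: "a \<in> supported_on ({..q} \<times> reduced D)"
      then obtain \<psi> where \<psi>: "\<psi> \<in> chains D q" "\<forall>k\<le>q. \<forall>m\<in>reduced D. \<psi> (k, m) = a (k, m)"
        using chain_exists by blast
      have "R \<psi> = a"
        using \<psi>(2) supported_onD[OF a] by (auto simp: R_def fun_eq_iff)
      then show "a \<in> R ` chains D q"
        using \<psi>(1) by blast
    qed
  qed
  ultimately show ?thesis
    using fun_pair.rank_nullity[OF R fin_subspace_chains[of D q]]
    by (simp add: dim_supported_on finite_reduced card_cartesian_product)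
qed

end

section \<open>The dimension of the space of leading coefficients\<close>

context form_system
begin

text \<open>Closing a chain imposes linear conditions on its top coefficient only, indexed by a form
  and a monomial of degree at most \<open>D\<close>. Their number does not depend on
  \<open>q\<close> and serves as \<open>C\<close>.\<close>

lemma dim_closed_chains_ge:
  "\<exists>C. \<forall>q. Suc q * card (reduced D) \<le> fun_space.dim (closed_chains D q) + C"
proof (intro exI allI)
  fix q
  let ?T = "{1..n} \<times> (\<Union>D'\<in>{..D}. monoms n D')"
  define L :: "(nat \<times> (nat \<Rightarrow>\<^sub>0 nat) \<Rightarrow> 'k) \<Rightarrow> nat \<times> (nat \<Rightarrow>\<^sub>0 nat) \<Rightarrow> 'k"
    where "L = (\<lambda>\<psi> x. if fst x \<in> {1..n} then contract (f (fst x)) (\<lambda>m. \<psi> (q, m)) (snd x) else 0)"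
  have L: "fun_linear L"
    by (rule fun_linearI) (auto simp: L_def fscale_apply contract_add contract_scale)
  have ker: "{\<psi> \<in> chains D q. L \<psi> = 0} = closed_chains D q"
    by (auto simp: closed_chains_def L_def fun_eq_iff)
  have fin: "finite ?T"
    by (simp add: finite_monoms)
  have "L ` chains D q \<subseteq> supported_on ?T"
  proof clarify
    fix \<psi> assume \<psi>: "\<psi> \<in> chains D q"
    then have supp: "(\<lambda>m. \<psi> (q, m)) \<in> supported_on (monoms n D)"
      by (auto simp: chains_def supported_on_def)
    have "i \<in> {1..n} \<and> m \<in> (\<Union>D'\<in>{..D}. monoms n D')" if nz: "L \<psi> (i, m) \<noteq> 0" for i m
    proof -
      have i: "i \<in> {1..n}" and "contract (f i) (\<lambda>m. \<psi> (q, m)) m \<noteq> 0"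
        using nz by (auto simp: L_def split: if_splits)
      then have "m \<in> monoms n (D - d i)"
        using contract_nonzero_monoms[OF vars homog supp] by blast
      moreover have "D - d i \<in> {..D}"
        by simp
      ultimately show ?thesis
        using i by blast
    qed
    then show "L \<psi> \<in> supported_on ?T"
      by (auto simp: supported_on_def)
  qed
  then have "fun_space.dim (L ` chains D q) \<le> card ?T"
    using fun_space.fin_subspace_dim_mono[OF fin_subspace_supported_on[OF fin]]
      dim_supported_on[OF fin] by metis
  then show "Suc q * card (reduced D) \<le> fun_space.dim (closed_chains D q) + card ?T"
    using fun_pair.rank_nullity[OF L fin_subspace_chains[of D q]] dim_chains[of D q] ker by simp
qed

lemma dim_closed_chains_le: "fun_space.dim (closed_chains D q) \<le> Suc q * card (reduced D)"
  unfolding dim_chains[symmetric]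
  by (rule fun_space.fin_subspace_dim_mono[OF fin_subspace_chains]) (auto simp: closed_chains_def)

lemma linear_eval: "fun_linear (\<lambda>\<psi> m. \<psi> (q, m))"
  by (rule fun_linearI) (auto simp: fscale_apply)

lemma fin_subspace_limits: "fun_space.fin_subspace (limits D q)"
  unfolding limits_def by (rule fun_pair.fin_subspace_image[OF linear_eval fin_subspace_closed_chains])

lemma limits_supported: "limits D q \<subseteq> supported_on (monoms n D)"
  by (auto simp: limits_def closed_chains_def chains_def supported_on_def)

lemma closed_chains_eval_0:
  "{\<psi> \<in> closed_chains D 0. (\<lambda>m. \<psi> (0, m)) = 0} \<subseteq> {0}"
proof clarify
  fix \<psi> assume \<psi>: "\<psi> \<in> closed_chains D 0" "(\<lambda>m. \<psi> (0, m)) = 0"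
  have "\<psi> (k, m) = 0" for k m
    using \<psi>(1) fun_cong[OF \<psi>(2), of m] by (cases k) (auto simp: closed_chains_def chains_def supported_on_def)
  then show "\<psi> = 0"
    by (auto simp: fun_eq_iff)
qed

text \<open>The last chain relation equates the coefficient of \<open>s^(q+1)\<close> with
  contractions of that of \<open>s^q\<close>. If the former vanishes, this is closedness one level
  lower.\<close>

lemma closed_chains_eval_Suc:
  "{\<psi> \<in> closed_chains D (Suc q). (\<lambda>m. \<psi> (Suc q, m)) = 0} = closed_chains D q"
proof safe
  fix \<psi> assume \<psi>: "\<psi> \<in> closed_chains D (Suc q)" "(\<lambda>m. \<psi> (Suc q, m)) = 0"
  have z: "\<psi> (Suc q, m) = 0" for m
    using fun_cong[OF \<psi>(2), of m] by simp
  have c: "\<psi> \<in> chains D (Suc q)"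
    using \<psi>(1) by (simp add: closed_chains_def)
  have "k \<le> q \<and> m \<in> monoms n D" if "\<psi> (k, m) \<noteq> 0" for k m
  proof -
    have "k \<le> Suc q \<and> m \<in> monoms n D"
      using c that by (auto simp: chains_def supported_on_def)
    then show ?thesis
      using z that by (metis le_SucE)
  qed
  then have "\<psi> \<in> supported_on ({..q} \<times> monoms n D)"
    by (auto simp: supported_on_def)
  then have "\<psi> \<in> chains D q"
    using c by (simp add: chains_def)
  moreover have "contract (f i) (\<lambda>m. \<psi> (q, m)) m = 0" if i: "i \<in> {1..n}" for i m
  proof -
    have "\<psi> (Suc q, m + Poly_Mapping.single i (d i)) = - contract (f i) (\<lambda>m. \<psi> (q, m)) m"
      using c i by (simp add: chains_def)
    then show ?thesis
      using z by simp
  qed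
  ultimately show "\<psi> \<in> closed_chains D q"
    by (simp add: closed_chains_def)
next
  fix \<psi> assume \<psi>: "\<psi> \<in> closed_chains D q"
  then have s: "\<psi> \<in> supported_on ({..q} \<times> monoms n D)"
    by (simp add: closed_chains_def chains_def)
  then have z: "\<psi> (Suc q, m) = 0" for m
    by (rule supported_onD) simp
  then show "(\<lambda>m. \<psi> (Suc q, m)) = 0"
    by (simp add: fun_eq_iff)
  have "\<psi> \<in> supported_on ({..Suc q} \<times> monoms n D)"
    using s by (fastforce simp: supported_on_def)
  then show "\<psi> \<in> closed_chains D (Suc q)"
    using \<psi> z by (simp add: closed_chains_def chains_def contract_zero less_Suc_eq)
qed

text \<open>The closed chains are filtered by their degree in \<open>s\<close>, and taking top
  coefficients identifies the successive quotients with the spaces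
  \<open>limits D j\<close>.\<close>

lemma dim_closed_chains: "fun_space.dim (closed_chains D q) = (\<Sum>j\<le>q. fun_space.dim (limits D j))"
proof (induction q)
  case 0
  have "fun_space.dim {\<psi> \<in> closed_chains D 0. (\<lambda>m. \<psi> (0, m)) = 0} = 0"
    using fun_space.dim_le_card[of "{\<psi> \<in> closed_chains D 0. (\<lambda>m. \<psi> (0, m)) = 0}" "{}"]
      closed_chains_eval_0 by simp
  then show ?case
    using fun_pair.rank_nullity[OF linear_eval[of 0] fin_subspace_closed_chains[of D 0]]
    by (simp add: limits_def)
next
  case (Suc q)
  then show ?case
    using fun_pair.rank_nullity[OF linear_eval[of "Suc q"] fin_subspace_closed_chains[of D "Suc q"]]
    by (simp add: limits_def[of D "Suc q"] closed_chains_eval_Suc)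
qed

text \<open>Multiplying a solution by \<open>s\<close> shifts its coefficients and keeps the leading
  one.\<close>

lemma limits_Suc: "limits D q \<subseteq> limits D (Suc q)"
proof
  fix \<phi> assume "\<phi> \<in> limits D q"
  then obtain \<psi> where \<psi>: "\<psi> \<in> closed_chains D q" "\<phi> = (\<lambda>m. \<psi> (q, m))"
    by (auto simp: limits_def)
  define \<psi>' where "\<psi>' = (\<lambda>(k, m). case k of 0 \<Rightarrow> 0 | Suc k \<Rightarrow> \<psi> (k, m))"
  have [simp]: "\<psi>' (0, m) = 0" "\<psi>' (Suc k, m) = \<psi> (k, m)" for k m
    by (simp_all add: \<psi>'_def)
  have c: "\<psi> \<in> chains D q"
    using \<psi>(1) by (simp add: closed_chains_def)
  have "k \<le> Suc q \<and> m \<in> monoms n D" if "\<psi>' (k, m) \<noteq> 0" for k m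
    using that c by (cases k) (auto simp: chains_def supported_on_def)
  then have "\<psi>' \<in> supported_on ({..Suc q} \<times> monoms n D)"
    by (auto simp: supported_on_def)
  moreover have "\<psi>' (Suc k, m + Poly_Mapping.single i (d i)) = - contract (f i) (\<lambda>m. \<psi>' (k, m)) m"
    if "i \<in> {1..n}" "k < Suc q" for i k m
    using that c by (cases k) (auto simp: chains_def contract_zero)
  ultimately have "\<psi>' \<in> closed_chains D (Suc q)"
    using \<psi>(1) by (simp add: closed_chains_def chains_def)
  moreover have "\<phi> = (\<lambda>m. \<psi>' (Suc q, m))"
    using \<psi>(2) by simp
  ultimately show "\<phi> \<in> limits D (Suc q)"
    unfolding limits_def by blast
qed

lemma limits_mono: "q \<le> q' \<Longrightarrow> limits D q \<subseteq> limits D q'"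
  by (rule lift_Suc_mono_le[of "limits D"]) (rule limits_Suc)

definition limit_space :: "nat \<Rightarrow> ((nat \<Rightarrow>\<^sub>0 nat) \<Rightarrow> 'k) set"
  where "limit_space D = (\<Union>q. limits D q)"

text \<open>The spaces increase inside the functions on the finite set \<open>monoms n D\<close>, so
  they are constant once the dimension is maximal.\<close>

lemma limits_stable: "\<exists>q0. \<forall>q\<ge>q0. limits D q = limit_space D"
proof -
  have "fun_space.dim (limits D q) \<le> card (monoms n D)" for q
    using fun_space.fin_subspace_dim_mono[OF fin_subspace_supported_on[OF finite_monoms] limits_supported]
    by (simp add: dim_supported_on finite_monoms)
  then obtain q0 where q0: "\<And>q. fun_space.dim (limits D q) \<le> fun_space.dim (limits D q0)"
    using ex_has_greatest_nat[of "\<lambda>_. True" 0 "\<lambda>q. fun_space.dim (limits D q)" "Suc (card (monoms n D))"]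
    by (auto simp: less_Suc_eq_le)
  have eq: "limits D q0 = limits D q" if "q0 \<le> q" for q
  proof (rule fun_space.fin_subspace_dim_eq[OF fin_subspace_limits])
    show "fun_space.subspace (limits D q0)"
      using fin_subspace_limits unfolding fun_space.fin_subspace_def by blast
    show "limits D q0 \<subseteq> limits D q"
      by (rule limits_mono[OF that])
    then show "fun_space.dim (limits D q0) = fun_space.dim (limits D q)"
      using fun_space.fin_subspace_dim_mono[OF fin_subspace_limits] q0 le_antisym by blast
  qed
  have "limits D q \<subseteq> limits D q0" for q
    using limits_mono[of q "max q q0" D] eq[of "max q q0"] by simp
  then have "limit_space D = limits D q0"
    unfolding limit_space_def by blast
  then show ?thesis
    using eq by metis
qed

lemma fin_subspace_limit_space: "fun_space.fin_subspace (limit_space D)"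
proof -
  obtain q where "limits D q = limit_space D"
    using limits_stable by blast
  then show ?thesis
    using fin_subspace_limits[of D q] by simp
qed

lemma subspace_limit_space: "fun_space.subspace (limit_space D)"
  using fin_subspace_limit_space unfolding fun_space.fin_subspace_def by blast

lemma limit_space_supported: "limit_space D \<subseteq> supported_on (monoms n D)"
  unfolding limit_space_def using limits_supported by blast

text \<open>Both inequalities come from comparing the growth in \<open>q\<close> of two expressions for the
  dimension of the space of closed chains.\<close>

lemma dim_limit_space: "fun_space.dim (limit_space D) = card (reduced D)"
proof -
  define h where "h = fun_space.dim (limit_space D)"
  define e where "e = card (reduced D)"
  define s where "s q = (\<Sum>j\<le>q. fun_space.dim (limits D j))" for q
  obtain q0 where q0: "\<And>q. q0 \<le> q \<Longrightarrow> limits D q = limit_space D"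
    using limits_stable by blast
  obtain C where C: "\<And>q. Suc q * e \<le> s q + C"
    using dim_closed_chains_ge[of D] unfolding dim_closed_chains e_def s_def by blast
  have s_e: "s q \<le> Suc q * e" for q
    using dim_closed_chains_le[of D q] unfolding dim_closed_chains e_def s_def .
  have le_h: "fun_space.dim (limits D j) \<le> h" for j
    unfolding h_def by (rule fun_space.fin_subspace_dim_mono[OF fin_subspace_limit_space])
      (auto simp: limit_space_def)
  have s_h: "s q \<le> Suc q * h" for q
    unfolding s_def using sum_bounded_above[of "{..q}" "\<lambda>j. fun_space.dim (limits D j)" h] le_h by simp
  have h_s: "Suc r * h \<le> s (q0 + r)" for r
  proof -
    have "Suc r * h = (\<Sum>j\<in>{q0..q0 + r}. fun_space.dim (limits D j))"
      using q0 by (simp add: h_def)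
    also have "\<dots> \<le> s (q0 + r)"
      unfolding s_def by (intro sum_mono2) auto
    finally show ?thesis .
  qed
  have "e \<le> h"
  proof (rule ccontr)
    assume "\<not> e \<le> h"
    then have "Suc C * Suc h \<le> Suc C * e"
      by (intro mult_le_mono2) simp
    \<comment> \<open>The level \<open>q = C\<close> is high enough: a gap of at least 1 per level
      accumulates to \<open>Suc C\<close> and exceeds the constant \<open>C\<close>.\<close>
    also have "\<dots> \<le> Suc C * h + C"
      using C[of C] s_h[of C] by simp
    finally show False
      by simp
  qed
  moreover have "h \<le> e"
  proof (rule ccontr)
    assume "\<not> h \<le> e"
    \<comment> \<open>From level \<open>q0\<close> on each summand equals \<open>h\<close>. The
      \<open>q0\<close> further levels in the upper bound contribute \<open>q0 * e\<close>, which a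
      gap of 1 on \<open>Suc r\<close> levels exceeds.\<close>
    define r where "r = q0 * e"
    have "Suc r * Suc e \<le> Suc r * h"
      using \<open>\<not> h \<le> e\<close> by (intro mult_le_mono2) simp
    also have "\<dots> \<le> Suc (q0 + r) * e"
      using h_s[of r] s_e[of "q0 + r"] by linarith
    finally show False
      by (simp add: r_def algebra_simps)
  qed
  ultimately show ?thesis
    by (simp add: h_def e_def)
qed

lemma limit_space_contract:
  assumes "\<phi> \<in> limit_space D" "i \<in> {1..n}"
  shows "contract (f i) \<phi> m = 0"
  using assms by (auto simp: limit_space_def limits_def closed_chains_def)

text \<open>Contractions commute with translations, so translating all coefficients of a closed
  chain gives a closed chain one degree lower.\<close>

lemma limit_space_translate:
  assumes "\<phi> \<in> limit_space (Suc D)" and j: "j \<in> {0..n}"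
  shows "(\<lambda>m. \<phi> (m + Poly_Mapping.single j 1)) \<in> limit_space D"
proof -
  let ?e = "Poly_Mapping.single j 1"
  obtain q \<psi> where \<psi>: "\<psi> \<in> closed_chains (Suc D) q" "\<phi> = (\<lambda>m. \<psi> (q, m))"
    using assms(1) by (auto simp: limit_space_def limits_def)
  define \<psi>' where "\<psi>' = (\<lambda>(k, m). \<psi> (k, m + ?e))"
  have c: "\<psi> \<in> chains (Suc D) q"
    using \<psi>(1) by (simp add: closed_chains_def)
  have iff: "m + ?e \<in> monoms n (Suc D) \<longleftrightarrow> m \<in> monoms n D" for m
    using j by (subst monoms_plus_iff) (auto simp: monom_degree_single)
  have "\<psi>' \<in> supported_on ({..q} \<times> monoms n D)"
    using c iff by (auto simp: \<psi>'_def chains_def supported_on_def)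
  moreover have con: "contract g (\<lambda>m. \<psi>' (k, m)) m = contract g (\<lambda>m. \<psi> (k, m)) (m + ?e)" for g k m
    unfolding \<psi>'_def by (simp add: contract_translate[of g "\<lambda>m. \<psi> (k, m)"])
  moreover have "\<psi>' (k, m + Poly_Mapping.single i (d i)) = \<psi> (k, m + ?e + Poly_Mapping.single i (d i))" for k m i
    by (simp add: \<psi>'_def ac_simps)
  ultimately have "\<psi>' \<in> closed_chains D q"
    using \<psi>(1) by (simp add: closed_chains_def chains_def)
  moreover have "(\<lambda>m. \<phi> (m + ?e)) = (\<lambda>m. \<psi>' (q, m))"
    by (simp add: \<psi>(2) \<psi>'_def)
  ultimately show ?thesis
    unfolding limit_space_def limits_def by blast
qed

text \<open>The exponents of \<open>T_1, ..., T_n\<close> range freely below the \<open>d i\<close>.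
  That of \<open>T_0\<close> fills up the degree, and the bound on \<open>D\<close> leaves room for
  this.\<close>

lemma card_reduced:
  assumes "(\<Sum>i\<in>{1..n}. d i) \<le> D"
  shows "card (reduced D) = (\<Prod>i\<in>{1..n}. d i)"
proof -
  let ?P = "Pi\<^sub>E {1..n} (\<lambda>i. {..<d i})"
  let ?g = "\<lambda>m. restrict (Poly_Mapping.lookup m) {1..n}"
  have deg: "monom_degree m = Poly_Mapping.lookup m 0 + (\<Sum>i\<in>{1..n}. Poly_Mapping.lookup m i)"
    if "Poly_Mapping.keys m \<subseteq> {0..n}" for m
    using monom_degree_superset[OF _ that] by (simp add: sum.atLeast_Suc_atMost)
  have "bij_betw ?g (reduced D) ?P"
  proof (rule bij_betwI')
    fix m m' assume m: "m \<in> reduced D" "m' \<in> reduced D"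
    show "?g m = ?g m' \<longleftrightarrow> m = m'"
    proof
      assume eq: "?g m = ?g m'"
      have pos: "Poly_Mapping.lookup m i = Poly_Mapping.lookup m' i" if "i \<in> {1..n}" for i
        using fun_cong[OF eq, of i] that by simp
      have "Poly_Mapping.lookup m i = Poly_Mapping.lookup m' i" for i
      proof -
        consider "i \<in> {1..n}" | "i = 0" | "i \<notin> {0..n}"
          by force
        then show ?thesis
        proof cases
          case 2
          have "(\<Sum>i\<in>{1..n}. Poly_Mapping.lookup m i) = (\<Sum>i\<in>{1..n}. Poly_Mapping.lookup m' i)"
            using pos by (rule sum.cong[OF refl])
          then show ?thesis
            using 2 m deg[of m] deg[of m'] by (simp add: reduced_def monoms_def)
        next
          case 3
          then have "i \<notin> Poly_Mapping.keys m" "i \<notin> Poly_Mapping.keys m'"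
            using m by (auto simp: reduced_def monoms_def)
          then show ?thesis
            by (simp add: in_keys_iff)
        qed (rule pos)
      qed
      then show "m = m'"
        by (rule poly_mapping_eqI)
    qed simp
  next
    fix m assume "m \<in> reduced D"
    then show "?g m \<in> ?P"
      by (auto simp: reduced_def)
  next
    fix a assume a: "a \<in> ?P"
    define b where "b i = (if i = 0 then D - (\<Sum>i\<in>{1..n}. a i) else if i \<in> {1..n} then a i else 0)" for i
    define m where "m = Abs_poly_mapping b"
    have "finite {i. b i \<noteq> 0}"
      by (rule finite_subset[of _ "{0..n}"]) (auto simp: b_def split: if_splits)
    then have m: "Poly_Mapping.lookup m i = b i" for i
      by (simp add: m_def)
    have keys: "Poly_Mapping.keys m \<subseteq> {0..n}"
      by (auto simp: in_keys_iff m b_def split: if_splits)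
    have "(\<Sum>i\<in>{1..n}. a i) \<le> (\<Sum>i\<in>{1..n}. d i)"
      using a by (intro sum_mono less_imp_le) auto
    moreover have "(\<Sum>i\<in>{1..n}. b i) = (\<Sum>i\<in>{1..n}. a i)"
      by (intro sum.cong) (auto simp: b_def)
    ultimately have "monom_degree m = D"
      using assms deg[OF keys] by (simp add: m b_def[of 0])
    moreover have "\<forall>i\<in>{1..n}. Poly_Mapping.lookup m i < d i"
      using a by (auto simp: m b_def)
    ultimately have "m \<in> reduced D"
      using keys by (simp add: reduced_def monoms_def)
    moreover have "a = ?g m"
      using a by (auto simp: fun_eq_iff m b_def PiE_def extensional_def)
    ultimately show "\<exists>m\<in>reduced D. a = ?g m"
      by blast
  qed
  then have "card (reduced D) = card ?P"
    by (rule bij_betw_same_card)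
  then show ?thesis
    by (simp add: card_PiE)
qed

end

section \<open>The common zero\<close>

text \<open>If each \<open>T_j\<close> acts on \<open>\<phi>\<close> as \<open>a j\<close> times one
  linear form, a monomial acts as its value at \<open>a\<close> times the power of that form given
  by its degree.\<close>

lemma translate_eq_eigenvalue_monomial:
  assumes eig: "\<And>j m. j \<in> {0..n} \<Longrightarrow> \<phi> (m + Poly_Mapping.single j 1) = a j * pencil n c \<phi> m"
    and "Poly_Mapping.keys \<mu> \<subseteq> {0..n}"
  shows "\<phi> (m + \<mu>) = (\<Prod>i\<in>{0..n}. a i ^ Poly_Mapping.lookup \<mu> i) * (pencil n c ^^ monom_degree \<mu>) \<phi> m"
  using assms(2)
proof (induction "monom_degree \<mu>" arbitrary: \<mu> m)
  case 0
  then have "\<forall>i. Poly_Mapping.lookup \<mu> i = 0"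
    by (auto simp: monom_degree_def in_keys_iff)
  then have "\<mu> = 0"
    by (intro poly_mapping_eqI) simp
  then show ?case
    by (simp add: monom_degree_def)
next
  case (Suc N)
  obtain j where j: "j \<in> Poly_Mapping.keys \<mu>"
    using Suc.hyps(2) by (fastforce simp: monom_degree_def)
  define \<nu> where "\<nu> = \<mu> - Poly_Mapping.single j 1"
  have \<mu>: "\<mu> = \<nu> + Poly_Mapping.single j 1"
    using j by (simp add: \<nu>_def minus_single_plus in_keys_iff Suc_le_eq)
  have N: "N = monom_degree \<nu>" and keys: "Poly_Mapping.keys \<nu> \<subseteq> {0..n}" and jn: "j \<in> {0..n}"
    using Suc.hyps(2) Suc.prems j
    by (auto simp: \<mu> monom_degree_plus monom_degree_single keys_plus_nat)
  let ?P = "\<lambda>\<mu>. \<Prod>i\<in>{0..n}. a i ^ Poly_Mapping.lookup \<mu> i"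
  have "?P \<mu> = (\<Prod>i\<in>{0..n}. a i ^ Poly_Mapping.lookup \<nu> i * (if i = j then a i else 1))"
    by (intro prod.cong) (auto simp: \<mu> lookup_plus_single)
  also have "\<dots> = ?P \<nu> * a j"
    using jn by (simp add: prod.distrib)
  finally have P: "?P \<mu> = ?P \<nu> * a j" .
  have "\<phi> (m + \<mu>) = a j * pencil n c \<phi> (m + \<nu>)"
    using eig[OF jn, of "m + \<nu>"] by (simp add: \<mu> add.assoc)
  also have "pencil n c \<phi> (m + \<nu>) = pencil n c (\<lambda>m. \<phi> (m + \<nu>)) m"
    by (rule pencil_translate[symmetric])
  also have "(\<lambda>m. \<phi> (m + \<nu>)) = fscale (?P \<nu>) ((pencil n c ^^ N) \<phi>)"
    using Suc.hyps(1)[OF N keys] N by (simp add: fun_eq_iff fscale_apply)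
  also have "pencil n c \<dots> m = ?P \<nu> * (pencil n c ^^ Suc N) \<phi> m"
  proof -
    interpret Vector_Spaces.linear fscale fscale "pencil n c"
      by (rule linear_pencil)
    show ?thesis
      by (simp add: scale fscale_apply)
  qed
  finally show ?case
    using P Suc.hyps(2) by (simp add: ac_simps)
qed

text \<open>By homogeneity all monomials of \<open>g\<close> involve the same power of the linear
  form, which factors out of the sum.\<close>

lemma contract_eq_eval:
  assumes eig: "\<And>j m. j \<in> {0..n} \<Longrightarrow> \<phi> (m + Poly_Mapping.single j 1) = a j * pencil n c \<phi> m"
    and vars: "mpoly_vars g \<subseteq> {0..n}" and homog: "homogeneous_of_degree d g"
  shows "contract g \<phi> m = mpoly_eval a g * (pencil n c ^^ d) \<phi> m"
proof -
  have "\<phi> (m + \<mu>) = (\<Prod>i\<in>Poly_Mapping.keys \<mu>. a i ^ Poly_Mapping.lookup \<mu> i) * (pencil n c ^^ d) \<phi> m"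
    if "\<mu> \<in> Poly_Mapping.keys g" for \<mu>
  proof -
    have keys: "Poly_Mapping.keys \<mu> \<subseteq> {0..n}" and deg: "monom_degree \<mu> = d"
      using that vars homog by (auto simp: mpoly_vars_def homogeneous_of_degree_def)
    have "(\<Prod>i\<in>Poly_Mapping.keys \<mu>. a i ^ Poly_Mapping.lookup \<mu> i)
        = (\<Prod>i\<in>{0..n}. a i ^ Poly_Mapping.lookup \<mu> i)"
      by (rule prod.mono_neutral_left) (use keys in \<open>auto simp: in_keys_iff\<close>)
    then show ?thesis
      using translate_eq_eigenvalue_monomial[OF eig keys, of m] deg by simp
  qed
  then show ?thesis
    by (simp add: contract_def mpoly_eval_def sum_distrib_right mult.assoc)
qed

context form_system
begin

lemma pencil_limit_space:
  assumes "\<phi> \<in> limit_space (Suc D)"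
  shows "pencil n c \<phi> \<in> limit_space D"
proof -
  have "pencil n c \<phi> = (\<Sum>j\<in>{0..n}. fscale (c ^ j) (\<lambda>m. \<phi> (m + Poly_Mapping.single j 1)))"
    by (simp add: fun_eq_iff pencil_def fun_apply_sum fscale_apply)
  also have "\<dots> \<in> limit_space D"
    using limit_space_translate[OF assms] subspace_limit_space
    by (intro fun_space.subspace_sum fun_space.subspace_scale) auto
  finally show ?thesis .
qed

text \<open>If the linear form kills \<open>\<phi>\<close>, it kills all translates of
  \<open>\<phi>\<close>. These have lower degree, so they vanish by induction, and so does
  \<open>\<phi>\<close>.\<close>

lemma pencil_inj_mono:
  assumes inj: "\<And>\<phi>. \<phi> \<in> limit_space D0 \<Longrightarrow> pencil n c \<phi> = 0 \<Longrightarrow> \<phi> = 0"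
    and "D0 \<le> D" "\<phi> \<in> limit_space D" "pencil n c \<phi> = 0"
  shows "\<phi> = 0"
  using assms(2-)
proof (induction D arbitrary: \<phi> rule: dec_induct)
  case base
  then show ?case
    using inj by blast
next
  case (step D)
  show ?case
  proof (rule eq_zero_if_translates_zero)
    show "\<phi> \<in> supported_on (monoms n (Suc D))"
      using step.prems(1) limit_space_supported by blast
    fix j m assume j: "j \<in> {0..n}"
    have "pencil n c (\<lambda>m. \<phi> (m + Poly_Mapping.single j 1)) = 0"
      by (rule ext) (simp add: pencil_translate step.prems(2))
    then have "(\<lambda>m. \<phi> (m + Poly_Mapping.single j 1)) = 0"
      using step.IH limit_space_translate[OF step.prems(1) j] by blast
    then show "\<phi> (m + Poly_Mapping.single j 1) = 0"
      by (rule fun_cong[where x = m, THEN trans]) simp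
  qed
qed

lemma common_zero:
  assumes K: "two_field TYPE('k)" and odd: "\<And>i. i \<in> {1..n} \<Longrightarrow> odd (d i)"
  shows "\<exists>a. (\<exists>j\<in>{0..n}. a j \<noteq> 0) \<and> (\<forall>i\<in>{1..n}. mpoly_eval a (f i) = 0)"
proof -
  define e where "e = (\<Prod>i\<in>{1..n}. d i)"
  \<comment> \<open>The summand \<open>e\<close> provides the bound on the dimension for
    \<open>pencil_injective\<close>, the sum the bound on the degree for
    \<open>card_reduced\<close>.\<close>
  define D0 where "D0 = e + (\<Sum>i\<in>{1..n}. d i)"
  have odd_e: "odd e"
    using odd by (auto simp: e_def even_prod_iff)
  have dim: "fun_space.dim (limit_space D) = e" if "D0 \<le> D" for D
    unfolding dim_limit_space e_def by (rule card_reduced) (use that in \<open>simp add: D0_def\<close>)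
  have "\<exists>c. c \<notin> {} \<and> (\<forall>\<phi>\<in>limit_space D0. pencil n c \<phi> = 0 \<longrightarrow> \<phi> = 0)"
  proof (rule pencil_injective[OF two_field_infinite[OF K] subspace_limit_space limit_space_supported])
    show "fun_space.dim (limit_space D0) \<le> D0"
      unfolding dim[OF order_refl] by (simp add: D0_def)
  qed simp
  then obtain c where c: "\<And>\<phi>. \<phi> \<in> limit_space D0 \<Longrightarrow> pencil n c \<phi> = 0 \<Longrightarrow> \<phi> = 0"
    by blast
  let ?l = "pencil n c"
  let ?X = "\<lambda>j \<phi> m. \<phi> (m + Poly_Mapping.single j 1)"
  interpret l: Vector_Spaces.linear fscale fscale ?l
    by (rule linear_pencil)
  have zero: "\<phi> = 0" if "D0 \<le> D" "\<phi> \<in> limit_space D" "?l \<phi> = 0" for D \<phi>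
    using pencil_inj_mono[OF c that] .
  have inj: "inj_on ?l (limit_space D)" if "D0 \<le> D" for D
    using zero[OF that] by (subst l.inj_on_iff_eq_0[OF subspace_limit_space]) blast
  \<comment> \<open>The margin over \<open>D0\<close> allows \<open>?l\<close> to be applied
    \<open>d i\<close> times within the degrees where it is injective.\<close>
  define D where "D = D0 + (\<Sum>i\<in>{1..n}. d i)"
  define E where "E = limit_space (Suc D)"
  have D: "D0 \<le> D" "D0 \<le> Suc D"
    by (simp_all add: D_def)
  have surj: "?l ` E = limit_space D"
  proof (rule fun_space.fin_subspace_dim_eq[OF fin_subspace_limit_space])
    show "fun_space.subspace (?l ` E)"
      unfolding E_def by (rule l.subspace_image[OF subspace_limit_space])
    show "?l ` E \<subseteq> limit_space D"
      unfolding E_def using pencil_limit_space by blast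
    have "{\<phi> \<in> E. ?l \<phi> = 0} \<subseteq> {0}"
      using zero[OF D(2)] by (auto simp: E_def)
    then have "fun_space.dim {\<phi> \<in> E. ?l \<phi> = 0} = 0"
      using fun_space.dim_le_card[of "{\<phi> \<in> E. ?l \<phi> = 0}" "{}"] by simp
    then show "fun_space.dim (?l ` E) = fun_space.dim (limit_space D)"
      using fun_pair.rank_nullity[OF linear_pencil[of n c] fin_subspace_limit_space[of "Suc D"]]
      by (simp add: dim D E_def)
  qed
  \<comment> \<open>\<open>?l\<close> is bijective from \<open>E\<close> to
    \<open>limit_space D\<close>, both of dimension \<open>e\<close>. With its inverse
    \<open>g\<close>, the operator \<open>Y j\<close> is the quotient of \<open>T_j\<close> by the
    linear form.\<close>
  obtain g where g: "fun_linear g" "\<And>\<phi>. \<phi> \<in> E \<Longrightarrow> g (?l \<phi>) = \<phi>"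
    using fun_pair.linear_exists_left_inverse_on[OF linear_pencil subspace_limit_space inj[OF D(2)]]
    unfolding E_def by blast
  have g_in: "g \<theta> \<in> E" and lg: "?l (g \<theta>) = \<theta>" if "\<theta> \<in> limit_space D" for \<theta>
    using that g(2) unfolding surj[symmetric] by auto
  define Y where "Y j = g \<circ> ?X j" for j
  have X_in: "?X j \<phi> \<in> limit_space D" if "j \<in> {0..n}" "\<phi> \<in> E" for j \<phi>
    using limit_space_translate that by (simp add: E_def)
  have Y_in: "Y j \<phi> \<in> E" and lY: "?l (Y j \<phi>) = ?X j \<phi>" if "j \<in> {0..n}" "\<phi> \<in> E" for j \<phi>
    using g_in[OF X_in[OF that]] lg[OF X_in[OF that]] by (simp_all add: Y_def)
  have llY: "?l (?l (Y i (Y j \<phi>))) = ?X i (?X j \<phi>)" if "i \<in> {0..n}" "j \<in> {0..n}" "\<phi> \<in> E" for i j \<phi>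
  proof -
    have "?l (?l (Y i (Y j \<phi>))) = ?l (?X i (Y j \<phi>))"
      by (simp only: lY[OF that(1) Y_in[OF that(2,3)]])
    also have "\<dots> = ?X i (?l (Y j \<phi>))"
      by (rule ext) (rule pencil_translate)
    finally show ?thesis
      by (simp only: lY[OF that(2,3)])
  qed
  have comm: "Y i (Y j \<phi>) = Y j (Y i \<phi>)" if "i \<in> {0..n}" "j \<in> {0..n}" "\<phi> \<in> E" for i j \<phi>
  proof -
    have in_E: "Y i (Y j \<phi>) \<in> E" "Y j (Y i \<phi>) \<in> E"
      using that Y_in by blast+
    \<comment> \<open>Clearing both denominators leaves the translations by \<open>T_i\<close> and
      \<open>T_j\<close>, which commute; \<open>?l\<close> is then cancelled in degrees
      \<open>D\<close> and \<open>Suc D\<close>.\<close>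
    have "?l (?l (Y i (Y j \<phi>))) = ?l (?l (Y j (Y i \<phi>)))"
      unfolding llY[OF that] llY[OF that(2,1,3)] by (simp add: ac_simps)
    then have "?l (Y i (Y j \<phi>)) = ?l (Y j (Y i \<phi>))"
      by (rule inj_onD[OF inj[OF D(1)]]) (use in_E surj in blast)+
    then show ?thesis
      by (rule inj_onD[OF inj[OF D(2)]]) (use in_E in \<open>simp_all add: E_def\<close>)
  qed
  have "\<exists>\<phi>\<in>E. \<phi> \<noteq> 0 \<and> (\<forall>j\<in>{0..n}. \<exists>a. Y j \<phi> = fscale a \<phi>)"
  proof (rule fun_space.odd_dim_common_eigenvector[OF K])
    show "fun_linear (Y j)" for j
      unfolding Y_def
      by (rule Vector_Spaces.linear_compose[OF _ g(1)], rule fun_linearI) (simp_all add: fscale_apply)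
    show "fun_space.fin_subspace E"
      unfolding E_def by (rule fin_subspace_limit_space)
    show "odd (fun_space.dim E)"
      using odd_e by (simp add: E_def dim D)
    show "Y j ` E \<subseteq> E" if "j \<in> {0..n}" for j
      using Y_in[OF that] by blast
  qed (rule comm)
  then obtain \<phi> a where \<phi>: "\<phi> \<in> E" "\<phi> \<noteq> 0" and a: "\<And>j. j \<in> {0..n} \<Longrightarrow> Y j \<phi> = fscale (a j) \<phi>"
    by metis
  have eig: "\<phi> (m + Poly_Mapping.single j 1) = a j * ?l \<phi> m" if "j \<in> {0..n}" for j m
  proof -
    have "?X j \<phi> = fscale (a j) (?l \<phi>)"
      using lY[OF that \<phi>(1)] a[OF that] l.scale by simp
    then show ?thesis
      by (simp add: fun_eq_iff fscale_apply)
  qed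
  \<comment> \<open>Each application of \<open>?l\<close> lowers the degree by one, and the degrees
    in which it acts stay above \<open>D0\<close>, so injectivity keeps the result nonzero.\<close>
  have pow: "(?l ^^ k) \<phi> \<in> limit_space (Suc D - k) \<and> (?l ^^ k) \<phi> \<noteq> 0" if "k \<le> D - D0" for k
    using that
  proof (induction k)
    case 0
    then show ?case
      using \<phi> unfolding E_def funpow_0 diff_zero by blast
  next
    case (Suc k)
    have IH: "(?l ^^ k) \<phi> \<in> limit_space (Suc D - k)" "(?l ^^ k) \<phi> \<noteq> 0"
      using Suc.IH[OF Suc_leD[OF Suc.prems]] by blast+
    have "Suc D - k = Suc (Suc D - Suc k)" "D0 \<le> Suc D - k"
      using Suc.prems by simp_all
    then show ?case
      using IH pencil_limit_space zero by (metis funpow.simps(2) o_apply)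
  qed
  have "\<exists>j\<in>{0..n}. a j \<noteq> 0"
  proof (rule ccontr)
    assume "\<not> ?thesis"
    then have "?l \<phi> = 0"
      using eig by (simp add: pencil_def fun_eq_iff)
    then show False
      using zero[OF D(2)] \<phi> by (simp add: E_def)
  qed
  moreover have "mpoly_eval a (f i) = 0" if i: "i \<in> {1..n}" for i
  proof -
    have "d i \<le> D - D0"
      unfolding D_def using member_le_sum[of i "{1..n}" d] i by simp
    then obtain m where "(?l ^^ d i) \<phi> m \<noteq> 0"
      using pow by (fastforce simp: fun_eq_iff)
    \<comment> \<open>Both sides equal \<open>contract (f i) \<phi> m\<close>: the left one by
      \<open>contract_eq_eval\<close>, the right one since \<open>\<phi>\<close> lies in a limit
      space.\<close>
    moreover have "mpoly_eval a (f i) * (?l ^^ d i) \<phi> m = 0"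
      using contract_eq_eval[OF eig vars[OF i] homog[OF i], of m] limit_space_contract[OF _ i, of \<phi> "Suc D" m] \<phi>(1)
      by (simp add: E_def)
    ultimately show ?thesis
      by simp
  qed
  ultimately show ?thesis
    by blast
qed

end

theorem corollary4p12:
  fixes f :: "nat \<Rightarrow> 'k::field mpoly"
    and d :: "nat \<Rightarrow> nat"
    and n r :: nat
  assumes "two_field TYPE('k)"
    and "r \<le> n"
    and "\<And>i. i \<in> {1..r} \<Longrightarrow> mpoly_vars (f i) \<subseteq> {0..n}"
    and "\<And>i. i \<in> {1..r} \<Longrightarrow> homogeneous_of_degree (d i) (f i)"
    and "\<And>i. i \<in> {1..r} \<Longrightarrow> odd (d i)"
  shows "\<exists>x :: nat \<Rightarrow> 'k. (\<exists>j\<in>{0..n}. x j \<noteq> 0) \<and> (\<forall>i\<in>{1..r}. mpoly_eval x (f i) = 0)"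
proof -
  define f' where "f' i = (if i \<le> r then f i else 0)" for i
  \<comment> \<open>The zero form counts as homogeneous of degree 1, which keeps all declared
    degrees odd.\<close>
  define d' where "d' i = (if i \<le> r then d i else 1)" for i
  have "form_system n f' d'"
    by unfold_locales
      (use assms(3,4) in \<open>auto simp: f'_def d'_def mpoly_vars_def homogeneous_of_degree_def\<close>)
  moreover have "odd (d' i)" if "i \<in> {1..n}" for i
    using assms(5) that by (auto simp: d'_def)
  ultimately obtain a where "\<exists>j\<in>{0..n}. a j \<noteq> 0" "\<forall>i\<in>{1..n}. mpoly_eval a (f' i) = 0"
    using form_system.common_zero[of n f' d'] assms(1) by blast
  moreover have "mpoly_eval a (f i) = 0" if "i \<in> {1..r}" for i
    using calculation(2) that \<open>r \<le> n\<close> by (force simp: f'_def)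
  ultimately show ?thesis
    by blast
qed

end
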